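(* Let $n$ be a positive integer and let $G=(G_1,\ldots,G_n)$ be a collection of $n$ graphs on a common vertex set $V$ with $|V|=n$, such that $\sigma_2(G_i)\ge n$ for all $i\in[n]$. Then for every pair of distinct vertices $u,v\in V$, at least one of the following holds: (B1) $G$ contains a rainbow Hamiltonian $u,v$-path; (B2) there exists a partition $V\setminus\{u,v\}=X\cup Y$ with $|X|,|Y|\ge 1$ such that for every $i\in[n]$, $G_i[X]$ and $G_i[Y]$ are disjoint cliques in $G_i$, and $u$ and $v$ are adjacent in $G_i$ to all vertices of $X\cup Y$; (B3) $n$ is even and there exists a partition $V=X\cup Y$ with $|X|=|Y|=n/2$ and $u,v\in X$ such that for every $i\in[n]$, the bipartite subgraph $G_i[X,Y]$ is complete bipartite.
   Context: For a graph $F$, $\sigma_2(F)=\min\{d_F(x)+d_F(y): x\ne y,\ xy\notin E(F)\}$ (the minimum degree sum over non-adjacent pairs). For a collection $G=(G_1,\ldots,G_m)$ of graphs on a common vertex set $V$ and a graph $H$ with $V(H)\subseteq V$, $G$ contains a rainbow $H$ if there is an injection $c:E(H)\to[m]$ with $e\in E(G_{c(e)})$ for every $e\in E(H)$. A Hamiltonian $u,v$-path is a path through all vertices of $V$ with endpoints $u$ and $v$. $G_i[X,Y]$ denotes the bipartite subgraph of $G_i$ consisting of edges between $X$ and $Y$. *)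

theory Defs
  imports "HOL-Library.Ramsey" "HOL-Library.Extended_Nat"
begin

text \<open>
  A finite simple graph is given by its vertex set \<open>V\<close> and its set \<open>E\<close> of two-element subsets
  of \<open>V\<close>.
\<close>

definition simple_graph :: "'a set \<Rightarrow> 'a set set \<Rightarrow> bool" where
  "simple_graph V E \<longleftrightarrow> finite V \<and> E \<subseteq> [V]\<^bsup>2\<^esup>"

definition degree :: "'a set set \<Rightarrow> 'a \<Rightarrow> nat" where
  "degree E x = card {e \<in> E. x \<in> e}"

text \<open>
  A complete graph has no non-adjacent pair; the minimum over the empty set is then \<open>\<infinity>\<close>.
\<close>

definition sigma2 :: "'a set \<Rightarrow> 'a set set \<Rightarrow> enat" where
  "sigma2 V E =
     Inf {enat (degree E x + degree E y) | x y. x \<in> V \<and> y \<in> V \<and> x \<noteq> y \<and> {x, y} \<notin> E}"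

definition induced_edges :: "'a set set \<Rightarrow> 'a set \<Rightarrow> 'a set set" where
  "induced_edges E X = {e \<in> E. e \<subseteq> X}"

definition bipartite_edges :: "'a set set \<Rightarrow> 'a set \<Rightarrow> 'a set \<Rightarrow> 'a set set" where
  "bipartite_edges E X Y = {e \<in> E. \<exists>x\<in>X. \<exists>y\<in>Y. e = {x, y}}"

text \<open>
  Disjointness of two cliques is that of components: no common vertex and no edge between them.
\<close>

definition disjoint_cliques :: "'a set set \<Rightarrow> 'a set \<Rightarrow> 'a set \<Rightarrow> bool" where
  "disjoint_cliques E X Y \<longleftrightarrow>
     clique X (induced_edges E X) \<and> clique Y (induced_edges E Y) \<and>
     X \<inter> Y = {} \<and> bipartite_edges E X Y = {}"

definition complete_bipartite :: "'a set \<Rightarrow> 'a set \<Rightarrow> 'a set set \<Rightarrow> bool" where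
  "complete_bipartite X Y E \<longleftrightarrow> X \<inter> Y = {} \<and> E = {{x, y} | x y. x \<in> X \<and> y \<in> Y}"

definition contains_rainbow ::
    "'a set \<Rightarrow> nat \<Rightarrow> (nat \<Rightarrow> 'a set set) \<Rightarrow> 'a set \<Rightarrow> 'a set set \<Rightarrow> bool" where
  "contains_rainbow V m G VH EH \<longleftrightarrow>
     simple_graph VH EH \<and> VH \<subseteq> V \<and>
     (\<exists>c. inj_on c EH \<and> c ` EH \<subseteq> {1..m} \<and> (\<forall>e\<in>EH. e \<in> G (c e)))"

definition path_edges :: "'a list \<Rightarrow> 'a set set" where
  "path_edges p = {{p ! i, p ! Suc i} | i. Suc i < length p}"

definition hamiltonian_path :: "'a set \<Rightarrow> 'a \<Rightarrow> 'a \<Rightarrow> 'a list \<Rightarrow> bool" where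
  "hamiltonian_path V u v p \<longleftrightarrow>
     p \<noteq> [] \<and> distinct p \<and> set p = V \<and> hd p = u \<and> last p = v"

end

theory Submission
  imports Defs
begin

text \<open>
  Enlarge the collection to an edge-maximal one without a rainbow Hamiltonian \<open>u,v\<close>-path. A
  rotation argument with two free colours then shows that \<open>u\<close> and \<open>v\<close> are adjacent to every other
  vertex in every colour, so that \<open>W = V - {u, v}\<close> has no rainbow Hamiltonian path at all, while
  maximality covers \<open>W\<close> by two disjoint rainbow paths \<open>p\<close> and \<open>q\<close> that leave four colours free.

  Since no rotation may join the two paths, the degree condition holds with equality: shifted
  along \<open>p\<close> and \<open>q\<close>, the neighbours of \<open>last p\<close> are exactly the non-neighbours of \<open>hd q\<close>, and
  they are the same in all free colours. Take \<open>p\<close> as short as possible. Then all vertices of \<open>p\<close>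
  have the same neighbours on \<open>q\<close>. If there are none, no edge of any colour joins \<open>p\<close> to \<open>q\<close>,
  which gives (B2). If there is one, \<open>p\<close> is a single vertex adjacent to exactly the odd positions of
  \<open>q\<close>, and this vertex together with the even positions is independent in every colour, which
  gives (B3). Non-free colours are reached by recolouring edges of the two paths. Both conclusions
  pass to the original collection, where equality in the degree condition supplies the edges.
\<close>

section \<open>Rainbow paths\<close>

text \<open>\<open>E c x y\<close> means that \<open>xy\<close> is an edge of colour \<open>c\<close>; \<open>C\<close> is the exact set of colours used.\<close>

inductive rainbow_path :: "('c \<Rightarrow> 'a \<Rightarrow> 'a \<Rightarrow> bool) \<Rightarrow> 'a list \<Rightarrow> 'c set \<Rightarrow> bool"
  for E where
  single: "rainbow_path E [x] {}"
| Cons: "E c x (hd p) \<Longrightarrow> c \<notin> C \<Longrightarrow> rainbow_path E p C \<Longrightarrow> rainbow_path E (x # p) (insert c C)"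

lemma rainbow_path_nonempty: "rainbow_path E p C \<Longrightarrow> p \<noteq> []"
  by (auto elim: rainbow_path.cases)

lemma rainbow_path_finite: "rainbow_path E p C \<Longrightarrow> finite C"
  by (induction rule: rainbow_path.induct) auto

lemma rainbow_path_card: "rainbow_path E p C \<Longrightarrow> length p = Suc (card C)"
  by (induction rule: rainbow_path.induct) (auto dest: rainbow_path_finite)

lemma rainbow_path_mono:
  "rainbow_path E p C \<Longrightarrow> (\<And>c x y. c \<in> C \<Longrightarrow> E c x y \<Longrightarrow> E' c x y) \<Longrightarrow> rainbow_path E' p C"
  by (induction rule: rainbow_path.induct) (auto intro: rainbow_path.intros)

lemma rainbow_path_append:
  assumes "rainbow_path E a A" "rainbow_path E b B" "A \<inter> B = {}" "c \<notin> A" "c \<notin> B"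
    and "E c (last a) (hd b)"
  shows "rainbow_path E (a @ b) (insert c (A \<union> B))"
  using assms
proof (induction rule: rainbow_path.induct)
  case (single x)
  then show ?case by (auto intro: rainbow_path.intros)
next
  case (Cons d x p C)
  have ne: "p \<noteq> []" using Cons.hyps(3) by (rule rainbow_path_nonempty)
  have "rainbow_path E (p @ b) (insert c (C \<union> B))" using Cons ne by auto
  then have "rainbow_path E (x # p @ b) (insert d (insert c (C \<union> B)))"
    using Cons ne by (intro rainbow_path.Cons) auto
  moreover have "insert d (insert c (C \<union> B)) = insert c (insert d C \<union> B)" by auto
  ultimately show ?case by simp
qed

text \<open>Inverse of \<open>rainbow_path_append\<close>. The colour \<open>c\<close> of the cut
  edge is reported because the rotations below get it back as a free colour.\<close>

lemma rainbow_path_split: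
  assumes "rainbow_path E (a @ b) C" "a \<noteq> []" "b \<noteq> []"
  obtains A B c where "rainbow_path E a A" "rainbow_path E b B" "A \<inter> B = {}"
    "c \<notin> A" "c \<notin> B" "E c (last a) (hd b)" "C = insert c (A \<union> B)"
proof -
  have "\<exists>A B c. rainbow_path E a A \<and> rainbow_path E b B \<and> A \<inter> B = {} \<and> c \<notin> A \<and> c \<notin> B \<and>
    E c (last a) (hd b) \<and> C = insert c (A \<union> B)"
    using assms
  proof (induction a arbitrary: C)
    case Nil
    then show ?case by simp
  next
    case (Cons x a)
    from Cons.prems obtain c D where D: "C = insert c D" "c \<notin> D" "E c x (hd (a @ b))"
      "rainbow_path E (a @ b) D"
      by (auto elim: rainbow_path.cases)
    show ?case
    proof (cases "a = []")
      case True
      with D show ?thesis by (intro exI[of _ "{}"] exI[of _ D] exI[of _ c])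
          (auto intro: rainbow_path.single)
    next
      case False
      obtain A B d where *: "rainbow_path E a A" "rainbow_path E b B" "A \<inter> B = {}"
        "d \<notin> A" "d \<notin> B" "E d (last a) (hd b)" "D = insert d (A \<union> B)"
        using Cons.IH[OF D(4) False Cons.prems(3)] by blast
      have "rainbow_path E (x # a) (insert c A)"
        using * D False by (intro rainbow_path.Cons) auto
      with * D False show ?thesis
        by (intro exI[of _ "insert c A"] exI[of _ B] exI[of _ d]) auto
    qed
  qed
  with that show thesis by blast
qed

text \<open>A colour sits on exactly one edge, so it names the place to cut. This serves to recolour
  a single edge and to locate a newly added edge in \<open>saturated_extension\<close>.\<close>

lemma rainbow_path_split_colour:
  assumes "rainbow_path E p C" "c \<in> C"
  obtains a b A B where "p = a @ b" "rainbow_path E a A" "rainbow_path E b B" "A \<inter> B = {}"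
    "c \<notin> A" "c \<notin> B" "E c (last a) (hd b)" "C = insert c (A \<union> B)"
proof -
  have "\<exists>a b A B. p = a @ b \<and> rainbow_path E a A \<and> rainbow_path E b B \<and> A \<inter> B = {} \<and>
    c \<notin> A \<and> c \<notin> B \<and> E c (last a) (hd b) \<and> C = insert c (A \<union> B)"
    using assms
  proof (induction rule: rainbow_path.induct)
    case (single x)
    then show ?case by simp
  next
    case (Cons d x p C)
    show ?case
    proof (cases "c = d")
      case True
      have "x # p = [x] @ p \<and> rainbow_path E [x] {} \<and> rainbow_path E p C \<and> {} \<inter> C = {} \<and>
        c \<notin> {} \<and> c \<notin> C \<and> E c (last [x]) (hd p) \<and> insert d C = insert c ({} \<union> C)"
        using Cons.hyps True by (simp add: rainbow_path.single)
      then show ?thesis by blast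
    next
      case False
      then obtain a b A B where *: "p = a @ b" "rainbow_path E a A" "rainbow_path E b B"
        "A \<inter> B = {}" "c \<notin> A" "c \<notin> B" "E c (last a) (hd b)" "C = insert c (A \<union> B)"
        using Cons by auto
      have ne: "a \<noteq> []" using *(2) by (rule rainbow_path_nonempty)
      have "rainbow_path E (x # a) (insert d A)"
        using * Cons ne by (intro rainbow_path.Cons) auto
      then have "x # p = (x # a) @ b \<and> rainbow_path E (x # a) (insert d A) \<and>
        rainbow_path E b B \<and> insert d A \<inter> B = {} \<and> c \<notin> insert d A \<and> c \<notin> B \<and>
        E c (last (x # a)) (hd b) \<and> insert d C = insert c (insert d A \<union> B)"
        using * Cons.hyps ne False by auto
      then show ?thesis by blast
    qed
  qed
  with that show thesis by blast
qed

lemma rainbow_path_rev: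
  assumes sym: "\<And>c x y. E c x y \<Longrightarrow> E c y x" and "rainbow_path E p C"
  shows "rainbow_path E (rev p) C"
  using assms(2)
proof (induction rule: rainbow_path.induct)
  case (single x)
  then show ?case by (simp add: rainbow_path.single)
next
  case (Cons c x p C)
  have ne: "p \<noteq> []" using Cons.hyps(3) by (rule rainbow_path_nonempty)
  have "rainbow_path E (rev p @ [x]) (insert c (C \<union> {}))"
    using Cons ne by (intro rainbow_path_append) (auto simp: last_rev intro: rainbow_path.single sym)
  then show ?case by simp
qed

lemma rainbow_path_of_complete:
  assumes "finite C" "length p = Suc (card C)" "distinct p"
    and "\<And>c x y. c \<in> C \<Longrightarrow> x \<in> set p \<Longrightarrow> y \<in> set p \<Longrightarrow> x \<noteq> y \<Longrightarrow> E c x y"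
  shows "rainbow_path E p C"
  using assms
proof (induction C arbitrary: p rule: finite_induct)
  case empty
  then obtain x where "p = [x]" by (auto simp: length_Suc_conv)
  then show ?case by (simp add: rainbow_path.single)
next
  case (insert c C)
  then obtain x y q where p: "p = x # y # q" by (auto simp: length_Suc_conv)
  have "rainbow_path E (y # q) C" using insert p by (intro insert.IH) auto
  then show ?case using insert p by (auto intro!: rainbow_path.Cons)
qed

section \<open>Positions in a list\<close>

lemma card_set_filter_nth:
  assumes "distinct r"
  shows "card {z \<in> set r. P z} = card {i. i < length r \<and> P (r ! i)}"
proof (rule bij_betw_same_card[symmetric])
  show "bij_betw (nth r) {i. i < length r \<and> P (r ! i)} {z \<in> set r. P z}"
    using assms by (auto simp: bij_betw_def inj_on_def nth_eq_iff_index_eq in_set_conv_nth)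
qed

lemma split_at_Suc:
  assumes "Suc j < length q"
  obtains a b where "q = a @ b" "length a = Suc j" "a \<noteq> []" "b \<noteq> []" "hd a = hd q"
    "last a = q ! j" "hd b = q ! Suc j"
proof (rule that)
  show "q = take (Suc j) q @ drop (Suc j) q" by simp
  show "last (take (Suc j) q) = q ! j" using assms by (simp add: take_Suc_conv_app_nth)
  show "hd (take (Suc j) q) = hd q" by simp
qed (use assms in \<open>auto simp: hd_drop_conv_nth\<close>)

section \<open>Collections without a rainbow Hamiltonian path\<close>

text \<open>The situation on \<open>W = V - {u, v}\<close>. Leaving out two vertices costs each
  degree at most 2, so the Ore bound \<open>card W + 2\<close> drops to \<open>card W - 2\<close>;
  it is stated with \<open>+ 2\<close> on the right to avoid truncated subtraction. The number of
  colours is still that of the whole vertex set.\<close>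

locale ore_collection =
  fixes E :: "'c \<Rightarrow> 'a \<Rightarrow> 'a \<Rightarrow> bool" and cols :: "'c set" and W :: "'a set"
  assumes sym: "E c x y \<Longrightarrow> E c y x"
    and irrefl: "\<not> E c x x"
    and finite_W: "finite W"
    and finite_cols: "finite cols"
    and card_cols: "card cols = card W + 2"
    and ore: "c \<in> cols \<Longrightarrow> x \<in> W \<Longrightarrow> y \<in> W \<Longrightarrow> x \<noteq> y \<Longrightarrow> \<not> E c x y \<Longrightarrow>
      card W \<le> card {z \<in> W. E c x z} + card {z \<in> W. E c y z} + 2"
    and no_ham: "rainbow_path E p C \<Longrightarrow> distinct p \<Longrightarrow> set p = W \<Longrightarrow> C \<subseteq> cols \<Longrightarrow> False"
begin

section \<open>Covers by two rainbow paths and their exchanges\<close>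

text \<open>\<open>F\<close> is exactly the set of free colours, those on neither path. Every
  exchange keeps this form with an updated \<open>F\<close>, so exchanges can be iterated.\<close>

definition cover :: "'a list \<Rightarrow> 'a list \<Rightarrow> 'c set \<Rightarrow> bool" where
  "cover p q F \<longleftrightarrow>
     (\<exists>P Q. rainbow_path E p P \<and> rainbow_path E q Q \<and> P \<inter> Q = {} \<and> P \<union> Q = cols - F) \<and>
     F \<subseteq> cols \<and> distinct (p @ q) \<and> set (p @ q) = W"

lemma coverE:
  assumes "cover p q F"
  obtains P Q where "rainbow_path E p P" "rainbow_path E q Q" "P \<inter> Q = {}" "P \<union> Q = cols - F"
    "F \<subseteq> cols" "distinct p" "distinct q" "set p \<inter> set q = {}" "set p \<union> set q = W"
    "p \<noteq> []" "q \<noteq> []"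
  using assms unfolding cover_def by (auto dest: rainbow_path_nonempty)

lemma coverI:
  assumes "rainbow_path E p P" "rainbow_path E q Q" "P \<inter> Q = {}" "P \<union> Q = cols - F"
    "F \<subseteq> cols" "distinct p" "distinct q" "set p \<inter> set q = {}" "set p \<union> set q = W"
  shows "cover p q F"
  using assms unfolding cover_def by auto

lemma cover_swap: "cover p q F \<Longrightarrow> cover q p F"
  unfolding cover_def by (metis Un_commute Int_commute distinct_append set_append)

lemma rev_path: "rainbow_path E p C \<Longrightarrow> rainbow_path E (rev p) C"
  using rainbow_path_rev sym by blast

lemma cover_rev_right: "cover p q F \<Longrightarrow> cover p (rev q) F"
  unfolding cover_def by (auto dest: rev_path)

lemma cover_rev_left: "cover p q F \<Longrightarrow> cover (rev p) q F"
  unfolding cover_def by (auto dest: rev_path)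

lemma cover_length: "cover p q F \<Longrightarrow> length p + length q = card W"
  by (metis cover_def distinct_card length_append)

lemma cover_free_subset: "cover p q F \<Longrightarrow> F \<subseteq> cols"
  by (simp add: cover_def)

text \<open>The two paths have \<open>card W - 2\<close> edges in total, and there are
  \<open>card W + 2\<close> colours.\<close>

lemma cover_card_free:
  assumes "cover p q F"
  shows "card F = 4"
proof -
  obtain P Q where *: "rainbow_path E p P" "rainbow_path E q Q" "P \<inter> Q = {}" "P \<union> Q = cols - F"
    "F \<subseteq> cols"
    using assms by (rule coverE)
  have "card (P \<union> Q) = card P + card Q"
    using * by (intro card_Un_disjoint) (auto dest: rainbow_path_finite)
  moreover have "card (cols - F) = card cols - card F"
    using * finite_cols by (intro card_Diff_subset) (auto intro: finite_subset)
  moreover have "card F \<le> card cols"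
    using * finite_cols by (intro card_mono)
  ultimately show ?thesis
    using * card_cols cover_length[OF assms] by (auto dest!: rainbow_path_card)
qed

text \<open>Such an edge would concatenate the two paths to a rainbow Hamiltonian path of
  \<open>W\<close>.\<close>

lemma cover_no_join:
  assumes "cover p q F" "f \<in> F"
  shows "\<not> E f (last p) (hd q)"
proof
  assume e: "E f (last p) (hd q)"
  obtain P Q where *: "rainbow_path E p P" "rainbow_path E q Q" "P \<inter> Q = {}" "P \<union> Q = cols - F"
    "F \<subseteq> cols" "distinct p" "distinct q" "set p \<inter> set q = {}" "set p \<union> set q = W"
    using assms by (elim coverE)
  have "rainbow_path E (p @ q) (insert f (P \<union> Q))"
    using * e assms(2) by (intro rainbow_path_append) auto
  then show False
    using no_ham[of "p @ q" "insert f (P \<union> Q)"] * assms(2) by auto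
qed

text \<open>Posa rotation at the head of the second path: the edge from \<open>hd a\<close> to
  \<open>hd b\<close> replaces the one from \<open>last a\<close> to \<open>hd b\<close>, and
  \<open>last a\<close> becomes the head. Colour \<open>f\<close> is spent, and the colour
  \<open>c\<close> of the dropped edge becomes free.\<close>

lemma cover_rotate:
  assumes "cover p (a @ b) F" "a \<noteq> []" "b \<noteq> []" "f \<in> F" "E f (hd a) (hd b)"
  obtains c where "cover p (rev a @ b) (insert c (F - {f}))"
proof -
  obtain P Q where *: "rainbow_path E p P" "rainbow_path E (a @ b) Q" "P \<inter> Q = {}"
    "P \<union> Q = cols - F" "F \<subseteq> cols" "distinct p" "distinct (a @ b)" "set p \<inter> set (a @ b) = {}"
    "set p \<union> set (a @ b) = W"
    using assms(1) by (rule coverE)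
  obtain A B c where **: "rainbow_path E a A" "rainbow_path E b B" "A \<inter> B = {}"
    "c \<notin> A" "c \<notin> B" "E c (last a) (hd b)" "Q = insert c (A \<union> B)"
    using rainbow_path_split[OF *(2) assms(2,3)] .
  have f: "f \<notin> A" "f \<notin> B" "f \<notin> P" using * ** assms(4) by auto
  have "rainbow_path E (rev a @ b) (insert f (A \<union> B))"
    using ** f assms by (intro rainbow_path_append rev_path) (auto simp: last_rev)
  then have "cover p (rev a @ b) (insert c (F - {f}))"
    using * ** f assms(4) by (intro coverI[OF *(1)]) auto
  then show thesis using that by blast
qed

text \<open>The first path takes the place of \<open>a\<close> in front of \<open>b\<close>, and
  \<open>a\<close> is left over as the new first path. If \<open>a\<close> is shorter than
  \<open>p\<close>, this contradicts a shortest choice of \<open>p\<close>.\<close>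

lemma cover_move:
  assumes "cover p (a @ b) F" "a \<noteq> []" "b \<noteq> []" "f \<in> F" "E f (last p) (hd b)"
  obtains c where "cover a (p @ b) (insert c (F - {f}))"
proof -
  obtain P Q where *: "rainbow_path E p P" "rainbow_path E (a @ b) Q" "P \<inter> Q = {}"
    "P \<union> Q = cols - F" "F \<subseteq> cols" "distinct p" "distinct (a @ b)" "set p \<inter> set (a @ b) = {}"
    "set p \<union> set (a @ b) = W"
    using assms(1) by (rule coverE)
  obtain A B c where **: "rainbow_path E a A" "rainbow_path E b B" "A \<inter> B = {}"
    "c \<notin> A" "c \<notin> B" "E c (last a) (hd b)" "Q = insert c (A \<union> B)"
    using rainbow_path_split[OF *(2) assms(2,3)] .
  have f: "f \<notin> A" "f \<notin> B" "f \<notin> P" using * ** assms(4) by auto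
  have "rainbow_path E (p @ b) (insert f (P \<union> B))"
    using * ** f assms by (intro rainbow_path_append) auto
  moreover have "A \<union> insert f (P \<union> B) = cols - insert c (F - {f})"
    using *(3,4,5) **(3-5) f assms(4) unfolding **(7) by blast
  moreover have "A \<inter> insert f (P \<union> B) = {}"
    using *(3) **(3,7) f by blast
  moreover have "insert c (F - {f}) \<subseteq> cols"
    using *(4,5) **(7) by blast
  moreover have "set a \<union> set (p @ b) = W" "set a \<inter> set (p @ b) = {}" "distinct a" "distinct (p @ b)"
    using *(6-9) by auto
  ultimately have "cover a (p @ b) (insert c (F - {f}))"
    by (intro coverI[OF **(1)])
  then show thesis using that by blast
qed

lemma cover_recolour_right:
  assumes "cover p (a @ b) F" "a \<noteq> []" "b \<noteq> []" "f \<in> F"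
    and "rainbow_path E a A" "rainbow_path E b B" "A \<inter> B = {}" "c \<notin> A" "c \<notin> B"
    and "rainbow_path E p P" "P \<inter> insert c (A \<union> B) = {}" "P \<union> insert c (A \<union> B) = cols - F"
    and "E f (last a) (hd b)"
  shows "cover p (a @ b) (insert c (F - {f}))"
proof -
  have "rainbow_path E (a @ b) (insert f (A \<union> B))"
    using assms by (intro rainbow_path_append) auto
  moreover have "F \<subseteq> cols" "distinct (a @ b)" "distinct p" "set p \<inter> set (a @ b) = {}"
    "set p \<union> set (a @ b) = W" using assms(1) by (auto simp: cover_def)
  ultimately show ?thesis
    using assms by (intro coverI[OF assms(10)]) auto
qed

text \<open>When all edges of both paths are also present in the free colour \<open>f\<close>, the
  one edge carrying \<open>c\<close> can be repainted with \<open>f\<close>. The paths stay the same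
  and \<open>c\<close> becomes free, so statements about free colours extend to all colours.\<close>

lemma cover_recolour:
  assumes "cover p q F" "f \<in> F" "c \<in> cols" "c \<notin> F"
    and "\<And>a b. p = a @ b \<Longrightarrow> a \<noteq> [] \<Longrightarrow> b \<noteq> [] \<Longrightarrow> E f (last a) (hd b)"
    and "\<And>a b. q = a @ b \<Longrightarrow> a \<noteq> [] \<Longrightarrow> b \<noteq> [] \<Longrightarrow> E f (last a) (hd b)"
  shows "cover p q (insert c (F - {f}))"
proof -
  have main: "cover p q (insert c (F - {f}))"
    if cov: "cover p q F" and PQ: "rainbow_path E p P" "rainbow_path E q Q" "P \<inter> Q = {}"
      "P \<union> Q = cols - F" and c: "c \<in> Q"
      and q: "\<And>a b. q = a @ b \<Longrightarrow> a \<noteq> [] \<Longrightarrow> b \<noteq> [] \<Longrightarrow> E f (last a) (hd b)" for p q P Q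
  proof -
    obtain a b A B where *: "q = a @ b" "rainbow_path E a A" "rainbow_path E b B" "A \<inter> B = {}"
      "c \<notin> A" "c \<notin> B" "E c (last a) (hd b)" "Q = insert c (A \<union> B)"
      using rainbow_path_split_colour[OF PQ(2) c] .
    then show ?thesis
      using cover_recolour_right[of p a b F f A B c P] cov PQ q[of a b] assms(2)
      by (auto dest: rainbow_path_nonempty)
  qed
  obtain P Q where *: "rainbow_path E p P" "rainbow_path E q Q" "P \<inter> Q = {}" "P \<union> Q = cols - F"
    using assms(1) by (elim coverE)
  then have "c \<in> P \<or> c \<in> Q" using assms(3,4) by blast
  then consider "c \<in> P" | "c \<in> Q" by blast
  then show ?thesis
  proof cases
    case 1
    have "cover q p (insert c (F - {f}))"
      using 1 * assms by (intro main[of q p Q P] cover_swap[OF assms(1)]) auto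
    then show ?thesis by (rule cover_swap)
  next
    case 2
    then show ?thesis using * assms by (intro main[of p q P Q]) auto
  qed
qed

section \<open>Neighbourhoods of the two facing ends\<close>

text \<open>Rotating with \<open>g\<close> makes \<open>q ! j\<close> the head of the second path;
  \<open>f\<close> is still free because \<open>f \<noteq> g\<close>, and would join
  \<open>last p\<close> to it.\<close>

lemma cover_end_disjoint_right:
  assumes "cover p q F" "f \<in> F" "g \<in> F" "f \<noteq> g" "Suc j < length q" "E f (last p) (q ! j)"
  shows "\<not> E g (hd q) (q ! Suc j)"
proof
  assume e: "E g (hd q) (q ! Suc j)"
  obtain a b where ab: "q = a @ b" "a \<noteq> []" "b \<noteq> []" "hd a = hd q" "last a = q ! j"
    "hd b = q ! Suc j"
    using split_at_Suc[OF assms(5)] by metis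
  obtain c where "cover p (rev a @ b) (insert c (F - {g}))"
    using cover_rotate[of p a b F g] assms e ab by metis
  from cover_no_join[OF this, of f] show False
    using assms ab by (simp add: hd_rev)
qed

lemma cover_flip: "cover p q F \<Longrightarrow> cover (rev q) (rev p) F"
  using cover_rev_left cover_rev_right cover_swap by blast

text \<open>Mirror image of \<open>cover_end_disjoint_right\<close>: flipping the cover exchanges
  the facing ends, hence also the roles of \<open>f\<close> and \<open>g\<close>.\<close>

lemma cover_end_disjoint_left:
  assumes "cover p q F" "f \<in> F" "g \<in> F" "f \<noteq> g" "Suc i < length p" "E f (last p) (p ! i)"
  shows "\<not> E g (hd q) (p ! Suc i)"
proof -
  have ne: "p \<noteq> []" "q \<noteq> []" using assms(1) by (auto elim: coverE)
  have "Suc (length p - Suc (Suc i)) < length (rev p)" using assms(5) by simp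
  from cover_end_disjoint_right[OF cover_flip[OF assms(1)] assms(3,2) _ this]
  show ?thesis
    using assms ne by (auto simp: rev_nth hd_rev last_rev Suc_diff_Suc)
qed

lemma cover_no_join_ends:
  assumes "cover p q F" "f \<in> F"
  shows "\<not> E f (last p) (last q)" "\<not> E f (hd q) (hd p)"
  using cover_no_join[OF cover_rev_right[OF assms(1)] assms(2)]
    cover_no_join[OF cover_rev_left[OF assms(1)] assms(2)] sym assms
  by (auto simp: hd_rev last_rev dest: coverE)

text \<open>The two ends have total degree at least \<open>card W - 2\<close>, which is also the number of
  positions left, so the non-crossing conditions above hold with equality.\<close>

lemma cover_complement:
  assumes "cover p q F" "f \<in> F" "g \<in> F" "f \<noteq> g" "Suc i < length (p @ q)" "Suc i \<noteq> length p"
  shows "E f (last p) ((p @ q) ! i) \<longleftrightarrow> \<not> E g (hd q) ((p @ q) ! Suc i)"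
proof -
  obtain P Q where *: "F \<subseteq> cols" "distinct p" "distinct q" "set p \<inter> set q = {}" "set p \<union> set q = W"
    "p \<noteq> []" "q \<noteq> []"
    using assms(1) by (rule coverE)
  define r m k where "r = p @ q" and "m = length r" and "k = length p"
  have r: "distinct r" "set r = W" "m = card W" using * cover_length[OF assms(1)]
    by (auto simp: r_def m_def)
  have km: "0 < k" "k < m" using * by (auto simp: k_def m_def r_def)
  \<comment> \<open>A position in \<open>I\<close> stands for an edge of one of the two paths; the
    seam from \<open>k - 1\<close> to \<open>k\<close> is left out. Below, \<open>A h\<close> holds
    the positions of neighbours of \<open>last p\<close>, and \<open>B h\<close> those of neighbours
    of \<open>hd q\<close>, shifted back by one.\<close>
  define I where "I = {i. Suc i < m \<and> Suc i \<noteq> k}"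
  have "I = {..<m-1} - {k-1}" using km by (auto simp: I_def)
  then have I: "card I = m - 2" "finite I" using km by (auto simp: card_Diff_subset)
  define A where "A h = {i. i < m \<and> E h (last p) (r ! i)}" for h
  define B where "B h = {i. Suc i < m \<and> E h (hd q) (r ! Suc i)}" for h
  have rk: "r ! (k - 1) = last p" "r ! k = hd q" "r ! 0 = hd p"
    using * by (simp_all add: r_def k_def m_def nth_append last_conv_nth hd_conv_nth)
  have rm: "r ! (m - 1) = last q"
    using * last_conv_nth[of r] by (simp add: r_def m_def)
  have A: "A h \<subseteq> I" if "h \<in> F" for h
  proof
    fix i assume i: "i \<in> A h"
    have "i \<noteq> m - 1" "i \<noteq> k - 1"
      using i cover_no_join_ends(1)[OF assms(1) that] rk rm irrefl by (auto simp: A_def)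
    with i km show "i \<in> I" by (auto simp: A_def I_def)
  qed
  have B: "B h \<subseteq> I" for h
    using rk irrefl km unfolding B_def I_def by auto
  \<comment> \<open>Position 0 is \<open>hd p\<close>, which is not adjacent to \<open>hd q\<close>,
    so the shift by one loses no neighbour.\<close>
  have "{i. i < m \<and> E h (hd q) (r ! i)} = Suc ` B h" if "h \<in> F" for h
  proof -
    have "i \<in> Suc ` B h" if "i < m" "E h (hd q) (r ! i)" for i
      using that cover_no_join_ends[OF assms(1) \<open>h \<in> F\<close>] rk
      by (cases i) (auto simp: B_def)
    then show ?thesis by (auto simp: B_def)
  qed
  then have cB: "card (B h) = card {z \<in> W. E h (hd q) z}" if "h \<in> F" for h
    using card_set_filter_nth[OF r(1), of "E h (hd q)"] that
    by (simp add: r(2) card_image flip: m_def)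
  have cA: "card (A h) = card {z \<in> W. E h (last p) z}" for h
    using card_set_filter_nth[OF r(1), of "E h (last p)"]
    by (simp add: A_def r(2) flip: m_def)
  have disj: "A h \<inter> B h' = {}" if hh: "h \<in> F" "h' \<in> F" "h \<noteq> h'" for h h'
  proof -
    have False if "i \<in> A h" "i \<in> B h'" for i
    proof (cases "Suc i < k")
      case True
      then show False using cover_end_disjoint_left[OF assms(1) hh, of i] that *
        by (auto simp: A_def B_def r_def k_def nth_append)
    next
      case False
      moreover have "Suc i \<noteq> k" using that(2) B by (auto simp: I_def)
      ultimately have "k \<le> i" by simp
      moreover from this have "Suc (i - k) < length q"
        using that(2) by (auto simp: B_def m_def r_def k_def)
      ultimately show False using cover_end_disjoint_right[OF assms(1) hh, of "i - k"] that *
        by (auto simp: A_def B_def r_def k_def m_def nth_append Suc_diff_le)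
    qed
    then show ?thesis by blast
  qed
  have fin: "finite (A h)" "finite (B h)" if "h \<in> F" for h
    using A[OF that] B I finite_subset by blast+
  have le: "card (A h) + card (B h') \<le> m - 2" if "h \<in> F" "h' \<in> F" "h \<noteq> h'" for h h'
    using card_Un_disjoint[OF fin(1) fin(2) disj, OF that(1,2) that] A[OF that(1)] B[of h'] I
      card_mono[of I "A h \<union> B h'"] by auto
  have ge: "m \<le> card (A h) + card (B h) + 2" if "h \<in> F" for h
  proof -
    have "last p \<in> W" "hd q \<in> W" using * by auto
    moreover have "last p \<noteq> hd q" using * by (metis disjoint_iff hd_in_set last_in_set)
    ultimately show ?thesis
      using ore[of h "last p" "hd q"] cover_no_join[OF assms(1) that] that * cA cB r by auto
  qed
  \<comment> \<open>The mixed sums for \<open>(f, g)\<close> and \<open>(g, f)\<close> are at most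
    \<open>m - 2\<close>, the pure sums for \<open>f\<close> and for \<open>g\<close> at least
    \<open>m - 2\<close>. Both pairs have the same total, so equality holds throughout.\<close>
  have "card (A f) + card (B g) = m - 2"
    using le[OF assms(2-4)] le[OF assms(3,2) assms(4)[symmetric]] ge[OF assms(2)] ge[OF assms(3)] km
    by linarith
  then have "card (A f \<union> B g) = card I"
    using card_Un_disjoint[OF fin(1) fin(2) disj, OF assms(2,3) assms(2-4)] I by simp
  then have "A f \<union> B g = I"
    using A[OF assms(2)] B[of g] I by (intro card_subset_eq) auto
  moreover have "i \<in> I" using assms(5,6) by (simp add: I_def m_def r_def k_def)
  ultimately have "i \<in> A f \<longleftrightarrow> i \<notin> B g" using disj[OF assms(2-4)] by blast
  then show ?thesis using assms(5) by (auto simp: A_def B_def m_def r_def)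
qed

lemma cover_other_colour:
  assumes "cover p q F"
  obtains h where "h \<in> F" "h \<noteq> f" "h \<noteq> g"
proof -
  have "\<not> F \<subseteq> {f, g}"
    using cover_card_free[OF assms] card_mono[of "{f, g}" F] card_insert_le_m1[of 2 "{g}" f] by auto
  then show thesis using that by blast
qed

text \<open>Comparing with a third free colour shows that the neighbours of \<open>last p\<close> are the same
  in all free colours.\<close>

lemma cover_end_colour:
  assumes "cover p q F" "f \<in> F" "g \<in> F" "z \<in> W"
  shows "E f (last p) z \<longleftrightarrow> E g (last p) z"
proof -
  obtain h where h: "h \<in> F" "h \<noteq> f" "h \<noteq> g" using cover_other_colour[OF assms(1)] .
  have "set (p @ q) = W" using assms(1) by (simp add: cover_def)
  then obtain i where i: "i < length (p @ q)" "z = (p @ q) ! i"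
    using assms(4) by (metis in_set_conv_nth)
  have ne: "p \<noteq> []" "q \<noteq> []" using assms(1) by (auto elim: coverE)
  consider "Suc i = length p" | "Suc i = length (p @ q)"
    | "Suc i < length (p @ q)" "Suc i \<noteq> length p"
    using i by linarith
  then show ?thesis
  proof cases
    case 1
    then have "z = last p" using i ne by (simp add: nth_append last_conv_nth flip: 1)
    then show ?thesis using irrefl by auto
  next
    case 2
    then have "i = length (p @ q) - 1" by simp
    then have "z = last (p @ q)" using i ne last_conv_nth[of "p @ q"] by simp
    then show ?thesis using ne cover_no_join_ends(1)[OF assms(1)] assms by auto
  next
    case 3
    then show ?thesis
      using cover_complement[OF assms(1) assms(2) h(1)] cover_complement[OF assms(1) assms(3) h(1)] h i
      by auto
  qed
qed

text \<open>The colours may now coincide: by \<open>cover_end_colour\<close>, \<open>f\<close> can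
  be exchanged for a free colour different from \<open>g\<close> before
  \<open>cover_complement\<close> is applied.\<close>

lemma cover_complement_right:
  assumes "cover p q F" "f \<in> F" "g \<in> F" "Suc j < length q"
  shows "E f (last p) (q ! j) \<longleftrightarrow> \<not> E g (hd q) (q ! Suc j)"
proof -
  obtain h where h: "h \<in> F" "h \<noteq> g" using cover_other_colour[OF assms(1)] by metis
  have "q ! j \<in> W" using assms by (auto simp: cover_def)
  then have "E f (last p) (q ! j) \<longleftrightarrow> E h (last p) (q ! j)"
    using assms h by (intro cover_end_colour)
  then show ?thesis
    using cover_complement[OF assms(1) h(1) assms(3) h(2), of "length p + j"] assms(4)
    by (simp add: nth_append)
qed

lemma cover_complement_left:
  assumes "cover p q F" "f \<in> F" "g \<in> F" "Suc i < length p"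
  shows "E f (last p) (p ! i) \<longleftrightarrow> \<not> E g (hd q) (p ! Suc i)"
proof -
  obtain h where h: "h \<in> F" "h \<noteq> g" using cover_other_colour[OF assms(1)] by metis
  have "p ! i \<in> W" using assms by (auto simp: cover_def)
  then have "E f (last p) (p ! i) \<longleftrightarrow> E h (last p) (p ! i)"
    using assms h by (intro cover_end_colour)
  then show ?thesis
    using cover_complement[OF assms(1) h(1) assms(3) h(2), of i] assms(4)
    by (simp add: nth_append)
qed

lemma cover_rotate_left:
  assumes "cover (a @ b) q F" "a \<noteq> []" "b \<noteq> []" "f \<in> F" "E f (last a) (last b)"
  obtains c where "cover (a @ rev b) q (insert c (F - {f}))"
proof -
  have "cover (rev q) (rev b @ rev a) F" using cover_flip[OF assms(1)] by simp
  moreover have "E f (hd (rev b)) (hd (rev a))" using assms(5) by (simp add: hd_rev sym)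
  ultimately obtain c where "cover (rev q) (rev (rev b) @ rev a) (insert c (F - {f}))"
    using cover_rotate[of "rev q" "rev b" "rev a" F f] assms(2-4) by auto
  from cover_flip[OF this] show thesis using that by simp
qed

section \<open>Covers with a shortest first path\<close>

text \<open>The minimum is over all covers and all free sets, so minimality survives every exchange
  that preserves the length of the first path.\<close>

definition minimal :: "'a list \<Rightarrow> 'a list \<Rightarrow> 'c set \<Rightarrow> bool" where
  "minimal p q F \<longleftrightarrow> cover p q F \<and> (\<forall>p' q' F'. cover p' q' F' \<longrightarrow> length p \<le> length p')"

lemma minimal_cover: "minimal p q F \<Longrightarrow> cover p q F"
  by (simp add: minimal_def)

lemma minimal_le: "minimal p q F \<Longrightarrow> cover p' q' F' \<Longrightarrow> length p \<le> length p'"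
  by (auto simp: minimal_def)

lemma minimal_eq: "minimal p q F \<Longrightarrow> cover p' q' F' \<Longrightarrow> length p' = length p \<Longrightarrow> minimal p' q' F'"
  by (auto simp: minimal_def)

lemma minimal_rev_right: "minimal p q F \<Longrightarrow> minimal p (rev q) F"
  by (simp add: minimal_def cover_rev_right)

text \<open>An edge to \<open>hd p\<close> would join the paths. An edge to a later vertex of
  \<open>p\<close> would let the reversed \<open>q\<close> take over the rest of \<open>p\<close>
  from there, leaving a shorter first path.\<close>

lemma minimal_hd_not_adj:
  assumes "minimal p q F" "f \<in> F" "z \<in> set p"
  shows "\<not> E f (hd q) z"
proof
  assume e: "E f (hd q) z"
  have cov: "cover p q F" using assms(1) by (rule minimal_cover)
  have ne: "p \<noteq> []" "q \<noteq> []" using cov by (auto elim: coverE)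
  obtain t where t: "t < length p" "z = p ! t" using assms(3) by (metis in_set_conv_nth)
  show False
  proof (cases t)
    case 0
    then show False using cover_no_join_ends(2)[OF cov assms(2)] e t ne by (simp add: hd_conv_nth)
  next
    case (Suc i)
    then obtain a b where ab: "p = a @ b" "length a = Suc i" "a \<noteq> []" "b \<noteq> []" "hd b = p ! Suc i"
      using split_at_Suc[of i p] t by metis
    have "cover (rev q) (a @ b) F" using cov ab cover_swap cover_rev_left by blast
    then obtain c where "cover a (rev q @ b) (insert c (F - {f}))"
      using cover_move[of "rev q" a b F f] ab assms e t Suc ne by (auto simp: last_rev)
    from minimal_le[OF assms(1) this] show False using ab by simp
  qed
qed

text \<open>On \<open>p\<close> the neighbours of \<open>last p\<close> are the shifted
  non-neighbours of \<open>hd q\<close>, and \<open>hd q\<close> has no neighbour there.\<close>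

lemma minimal_last_adj:
  assumes "minimal p q F" "f \<in> F" "z \<in> set p" "z \<noteq> last p"
  shows "E f (last p) z"
proof -
  obtain i where i: "i < length p" "z = p ! i" using assms(3) by (metis in_set_conv_nth)
  have "Suc i \<noteq> length p"
    using i assms(4) last_conv_nth[of p] by (metis diff_Suc_1 length_0_conv less_nat_zero_code)
  then have "Suc i < length p" using i by simp
  then show ?thesis
    using cover_complement_left[OF minimal_cover[OF assms(1)] assms(2,2), of i]
      minimal_hd_not_adj[OF assms(1,2), of "p ! Suc i"] i by simp
qed

text \<open>Every vertex of \<open>p\<close> can be made its last one: \<open>hd p\<close> by
  reversal, any other by a rotation inside \<open>p\<close>, possible since \<open>last p\<close> is
  adjacent to all of \<open>p\<close>. The rotation spends a third colour \<open>h\<close>, so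
  \<open>f\<close> and \<open>g\<close> stay free.\<close>

lemma minimal_complement:
  assumes "minimal p q F" "f \<in> F" "g \<in> F" "z \<in> set p" "Suc j < length q"
  shows "E f z (q ! j) \<longleftrightarrow> \<not> E g (hd q) (q ! Suc j)"
proof -
  have cov: "cover p q F" using assms(1) by (rule minimal_cover)
  have ne: "p \<noteq> []" "q \<noteq> []" and dist: "distinct p" using cov by (auto elim: coverE)
  obtain t where t: "t < length p" "z = p ! t" using assms(4) by (metis in_set_conv_nth)
  show ?thesis
  proof (cases t)
    case 0
    then show ?thesis
      using cover_complement_right[OF cover_rev_left[OF cov] assms(2,3,5)] t ne
      by (simp add: last_rev hd_conv_nth)
  next
    case (Suc i)
    then obtain a b where ab: "p = a @ b" "a \<noteq> []" "b \<noteq> []" "hd b = p ! Suc i"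
      using split_at_Suc[of i p] t by metis
    obtain h where h: "h \<in> F" "h \<noteq> f" "h \<noteq> g" using cover_other_colour[OF cov] .
    have "last a \<noteq> last p" using ab dist by (metis disjoint_iff distinct_append last_appendR last_in_set)
    then have "E h (last a) (last b)"
      using minimal_last_adj[OF assms(1) h(1), of "last a"] ab sym by auto
    then obtain c where c: "cover (a @ rev b) q (insert c (F - {h}))"
      using cover_rotate_left[of a b q F h] cov ab h by metis
    show ?thesis
      using cover_complement_right[OF c, of f g j] assms h ab t Suc by (simp add: last_rev)
  qed
qed

text \<open>By \<open>minimal_complement\<close>, adjacency to \<open>q ! j\<close> depends on
  \<open>hd q\<close> alone. The last vertex of \<open>q\<close>, which has no successor, is the
  head of \<open>rev q\<close> and has no neighbour on \<open>p\<close>.\<close>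

lemma minimal_twins:
  assumes "minimal p q F" "f \<in> F" "g \<in> F" "z \<in> set p" "z' \<in> set p" "w \<in> set q"
  shows "E f z w \<longleftrightarrow> E g z' w"
proof -
  obtain j where j: "j < length q" "w = q ! j" using assms(6) by (metis in_set_conv_nth)
  show ?thesis
  proof (cases "Suc j < length q")
    case True
    then show ?thesis
      using minimal_complement[OF assms(1,2,2,4) True] minimal_complement[OF assms(1,3,2,5) True] j
      by simp
  next
    case False
    then have "w = hd (rev q)" using j last_conv_nth[of q]
      by (metis Suc_lessI diff_Suc_1 hd_rev length_0_conv less_nat_zero_code)
    then show ?thesis
      using minimal_hd_not_adj[OF minimal_rev_right[OF assms(1)]] assms sym by metis
  qed
qed

text \<open>For free colours this is \<open>minimal_twins\<close>. Any other \<open>c\<close> is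
  first made free by recolouring with a free \<open>h \<noteq> f\<close>; then \<open>f\<close> is
  still free and \<open>c\<close> can be compared with it.\<close>

lemma minimal_no_cross:
  assumes "minimal p q F" "f \<in> F" and none: "\<And>w. w \<in> set q \<Longrightarrow> \<not> E f (last p) w"
    and "c \<in> cols" "z \<in> set p" "w \<in> set q"
  shows "\<not> E c z w"
proof (cases "c \<in> F")
  case True
  have "last p \<in> set p" using assms(5) by (cases p) auto
  then show ?thesis using minimal_twins[OF assms(1) True assms(2,5) _ assms(6)] none[OF assms(6)] by blast
next
  case False
  have cov: "cover p q F" using assms(1) by (rule minimal_cover)
  have ne: "p \<noteq> []" "q \<noteq> []" and dist: "distinct p" "distinct q" and W: "W = set p \<union> set q"
    and disj: "set p \<inter> set q = {}"
    using cov by (auto elim: coverE)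
  obtain h where h: "h \<in> F" "h \<noteq> f" using cover_other_colour[OF cov] by metis
  have cross: "\<not> E h z w" if "z \<in> set p" "w \<in> set q" for z w
    using minimal_twins[OF assms(1) h(1) assms(2) that(1) last_in_set[OF ne(1)] that(2)] none that by blast
  \<comment> \<open>Without cross edges the degrees in \<open>h\<close> are at most
    \<open>length p - 1\<close> and \<open>length q - 1\<close>, whose sum is exactly the Ore bound.
    Hence both vertex sets are cliques in \<open>h\<close>, and \<open>h\<close> is available on
    every edge of the two paths.\<close>
  have cliques: "{z' \<in> W. E h z z'} = set p - {z} \<and> {w' \<in> W. E h w w'} = set q - {w}"
    if zw: "z \<in> set p" "w \<in> set q" for z w
  proof -
    have sub: "{z' \<in> W. E h z z'} \<subseteq> set p - {z}" "{w' \<in> W. E h w w'} \<subseteq> set q - {w}"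
      using cross sym irrefl zw W by blast+
    have "card (set p - {z}) = length p - 1" "card (set q - {w}) = length q - 1"
      using zw dist by (simp_all add: distinct_card)
    moreover have "length p > 0" "length q > 0" using ne by auto
    moreover have "h \<in> cols" using h cover_free_subset[OF cov] by blast
    then have "card W \<le> card {z' \<in> W. E h z z'} + card {w' \<in> W. E h w w'} + 2"
      using zw cross W disj by (intro ore) auto
    moreover have "card {z' \<in> W. E h z z'} \<le> card (set p - {z})"
      "card {w' \<in> W. E h w w'} \<le> card (set q - {w})"
      using sub by (auto intro!: card_mono)
    ultimately have "card {z' \<in> W. E h z z'} = card (set p - {z})"
      "card {w' \<in> W. E h w w'} = card (set q - {w})"
      using cover_length[OF cov] by linarith+
    then show ?thesis using sub by (intro conjI card_subset_eq) simp_all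
  qed
  have "cover p q (insert c (F - {h}))"
  proof (rule cover_recolour[OF cov h(1) assms(4) False])
    fix a b assume ab: "p = a @ b" "a \<noteq> []" "b \<noteq> []"
    then have "hd b \<noteq> last a"
      using dist by (metis disjoint_iff distinct_append hd_in_set last_in_set)
    then have "hd b \<in> set p - {last a}" using ab by simp
    moreover have "last a \<in> set p" using ab by auto
    ultimately show "E h (last a) (hd b)" using cliques[OF _ assms(6)] by blast
  next
    fix a b assume ab: "q = a @ b" "a \<noteq> []" "b \<noteq> []"
    then have "hd b \<noteq> last a"
      using dist by (metis disjoint_iff distinct_append hd_in_set last_in_set)
    then have "hd b \<in> set q - {last a}" using ab by simp
    moreover have "last a \<in> set q" using ab by auto
    ultimately show "E h (last a) (hd b)" using cliques[OF assms(5)] by blast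
  qed
  then have "minimal p q (insert c (F - {h}))" using minimal_eq[OF assms(1)] by blast
  from minimal_twins[OF this _ _ assms(5) last_in_set[OF ne(1)] assms(6), of c f]
  show ?thesis using none[OF assms(6)] assms(2) h by blast
qed

section \<open>Neighbours of the first path on the second\<close>

text \<open>Otherwise \<open>cover_move\<close> would cut off the first \<open>j\<close> vertices of
  \<open>q\<close> as a first path shorter than \<open>p\<close>.\<close>

lemma minimal_position_ge:
  assumes "minimal p q F" "f \<in> F" "j < length q" "E f (last p) (q ! j)"
  shows "length p \<le> j"
proof (cases j)
  case 0
  have cov: "cover p q F" using assms(1) by (rule minimal_cover)
  then have "q \<noteq> []" by (auto elim: coverE)
  then show ?thesis using 0 cover_no_join[OF cov assms(2)] assms(4) by (simp add: hd_conv_nth)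
next
  case (Suc i)
  then obtain a b where ab: "q = a @ b" "length a = Suc i" "a \<noteq> []" "b \<noteq> []" "hd b = q ! Suc i"
    using split_at_Suc[of i q] assms(3) by metis
  then obtain c where "cover a (p @ b) (insert c (F - {f}))"
    using cover_move[of p a b F f] minimal_cover[OF assms(1)] assms Suc by auto
  from minimal_le[OF assms(1) this] show ?thesis using ab Suc by simp
qed

lemma minimal_position_le:
  assumes "minimal p q F" "f \<in> F" "j < length q" "E f (last p) (q ! j)"
  shows "length p + j < length q"
proof -
  have "length q - Suc j < length (rev q)" using assms(3) by simp
  from minimal_position_ge[OF minimal_rev_right[OF assms(1)] assms(2) this]
  have "length p \<le> length q - Suc j" using assms by (simp add: rev_nth)
  then show ?thesis using assms(3) by simp
qed

text \<open>Two consecutive neighbours of \<open>p\<close> on \<open>q\<close> would allow \<open>p\<close> to be inserted between them.\<close>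

lemma minimal_not_consecutive:
  assumes "minimal p q F" "f \<in> F" "Suc j < length q" "E f (last p) (q ! j)"
  shows "\<not> E f (last p) (q ! Suc j)"
proof
  assume e: "E f (last p) (q ! Suc j)"
  have cov: "cover p q F" using assms(1) by (rule minimal_cover)
  have ne: "p \<noteq> []" using cov by (auto elim: coverE)
  obtain a b where ab: "q = a @ b" "a \<noteq> []" "b \<noteq> []" "last a = q ! j" "hd b = q ! Suc j"
    using split_at_Suc[OF assms(3)] by metis
  obtain g where g: "g \<in> F" "g \<noteq> f" using cover_other_colour[OF cov] by metis
  \<comment> \<open>With \<open>f\<close>, \<open>p\<close> is attached to the end of
    \<open>a\<close>; the remaining part \<open>b\<close> could then be joined to
    \<open>hd p\<close> with \<open>g\<close>.\<close>
  have "cover p (rev b @ rev a) F" using cover_rev_right[OF cov] ab by simp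
  then obtain c where "cover (rev b) (p @ rev a) (insert c (F - {f}))"
    using cover_move[of p "rev b" "rev a" F f] assms ab by (auto simp: hd_rev)
  from cover_no_join[OF cover_flip[OF this], of g] have "\<not> E g (hd p) (hd b)"
    using g ab ne by (simp add: last_rev)
  moreover have "E g (hd p) (q ! Suc j)"
    using minimal_twins[OF assms(1,2) g(1), of "last p" "hd p" "q ! Suc j"] e ne assms(3) by simp
  ultimately show False using ab by simp
qed

text \<open>If \<open>p\<close> were longer, \<open>q ! (j + 2)\<close> would exist and, as
  \<open>q ! (j + 1)\<close> is not a neighbour of \<open>last p\<close>, be adjacent to
  \<open>hd q\<close>. Rotating there moves the neighbour \<open>q ! j\<close> to position 1, which
  is below \<open>length p\<close>.\<close>

lemma minimal_singleton:
  assumes "minimal p q F" "f \<in> F" "j < length q" "E f (last p) (q ! j)"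
  shows "length p = 1"
proof (rule ccontr)
  assume neq: "length p \<noteq> 1"
  have cov: "cover p q F" using assms(1) by (rule minimal_cover)
  have ne: "p \<noteq> []" using cov by (auto elim: coverE)
  then have "length p > 1" using neq by (cases "length p") auto
  then have len: "Suc (Suc j) < length q" using minimal_position_le[OF assms] by simp
  obtain g where g: "g \<in> F" "g \<noteq> f" using cover_other_colour[OF cov] by metis
  have "\<not> E f (last p) (q ! Suc j)" using minimal_not_consecutive[OF assms(1,2) _ assms(4)] len by simp
  then have e: "E g (hd q) (q ! Suc (Suc j))"
    using cover_complement_right[OF cov assms(2) g(1) len] by simp
  obtain a b where ab: "q = a @ b" "length a = Suc (Suc j)" "a \<noteq> []" "b \<noteq> []" "hd a = hd q"
    "hd b = q ! Suc (Suc j)"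
    using split_at_Suc[OF len] by metis
  obtain c where c: "cover p (rev a @ b) (insert c (F - {g}))"
    using cover_rotate[of p a b F g] cov ab(1,3-6) g(1) e by metis
  have "(rev a @ b) ! 1 = q ! j" using ab by (simp add: nth_append rev_nth)
  then have "length p \<le> 1"
    using minimal_position_ge[OF minimal_eq[OF assms(1) c], of f 1] assms g ab by simp
  then show False using \<open>length p > 1\<close> by simp
qed

text \<open>With \<open>p = [x]\<close> and \<open>q = y # q'\<close>, the vertices \<open>x\<close>
  and \<open>y\<close> can be exchanged, so the facts on minimal covers apply to both. Neither has
  two consecutive neighbours on \<open>q'\<close>, and the complement rule ties \<open>x\<close> at
  \<open>j\<close> to \<open>y\<close> at \<open>j + 1\<close>; this forces alternation. The last
  vertex of \<open>q\<close> is not adjacent to \<open>x\<close>, so \<open>length q\<close> is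
  odd.\<close>

lemma minimal_alternating_first:
  assumes "minimal p q F" "f \<in> F" "1 < length q" "E f (last p) (q ! 1)"
  shows "odd (length q)" "t < length q \<Longrightarrow> E f (last p) (q ! t) \<longleftrightarrow> odd t"
proof -
  have cov: "cover p q F" using assms(1) by (rule minimal_cover)
  have "length p = 1" using minimal_singleton[OF assms] .
  then obtain x where p: "p = [x]" by (auto simp: length_Suc_conv)
  obtain y q' where q: "q = y # q'" "q' \<noteq> []" using assms(3) by (cases q) auto
  obtain g where g: "g \<in> F" "g \<noteq> f" using cover_other_colour[OF cov] by metis
  have "q ! 1 \<in> W" using cov assms(3) by (auto simp: cover_def)
  then have "E g x (hd q')"
    using cover_end_colour[OF cov g(1) assms(2)] assms(4) q p by (simp add: hd_conv_nth)
  then obtain c where c: "cover [y] (x # q') (insert c (F - {g}))"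
    using cover_move[of p "[y]" q' F g] cov q p g by auto
  have f: "f \<in> insert c (F - {g})" using assms g by simp
  have swapped: "minimal [y] (x # q') (insert c (F - {g}))"
    using minimal_eq[OF assms(1) c] p by simp
  have y: "\<not> (E f y (q ! j) \<and> E f y (q ! Suc j))" if "0 < j" "Suc j < length q" for j
    using minimal_not_consecutive[OF swapped f, of j] that q by (cases j) auto
  have y_last: "\<not> E f y (last q)" using cover_no_join_ends(1)[OF c f] q by simp
  have x: "\<not> (E f x (q ! j) \<and> E f x (q ! Suc j))" if "Suc j < length q" for j
    using minimal_not_consecutive[OF assms(1,2), of j] that p by auto
  have xy: "E f x (q ! j) \<longleftrightarrow> \<not> E f y (q ! Suc j)" if "Suc j < length q" for j
    using cover_complement_right[OF cov assms(2,2) that] p q by simp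
  have alt: "E f x (q ! t) \<longleftrightarrow> odd t" if "t < length q" for t
    using that
  proof (induction t)
    case 0
    then show ?case using cover_no_join[OF cov assms(2)] p q by simp
  next
    case (Suc t)
    show ?case
    proof (cases "E f x (q ! t)")
      case True
      then show ?thesis using x[of t] Suc by auto
    next
      case False
      then have ev: "even t" using Suc by auto
      show ?thesis
      proof (cases "t = 0")
        case True
        then show ?thesis using assms(4) p by simp
      next
        case nz: False
        \<comment> \<open>As \<open>y\<close> misses \<open>last q\<close>, position
          \<open>t + 2\<close> exists. There \<open>y\<close> has no neighbour, being adjacent to
          \<open>q ! (t + 1)\<close>, and so \<open>xy\<close> makes \<open>q ! (t + 1)\<close> a
          neighbour of \<open>x\<close>.\<close>
        have yt: "E f y (q ! Suc t)" using False xy[OF Suc.prems] by simp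
        have "Suc t \<noteq> length q - 1"
          using yt y_last q(2) last_conv_nth[of q] unfolding q(1) by (metis list.distinct(1))
        then have "Suc (Suc t) < length q" using Suc.prems by simp
        then show ?thesis using y[of "Suc t"] yt xy[of "Suc t"] ev by auto
      qed
    qed
  qed
  then show "t < length q \<Longrightarrow> E f (last p) (q ! t) \<longleftrightarrow> odd t" using p by simp
  have "\<not> E f x (q ! (length q - 1))"
    using cover_no_join_ends(1)[OF cov assms(2)] p q last_conv_nth[of q] by simp
  then show "odd (length q)" using alt[of "length q - 1"] q by auto
qed

text \<open>The neighbour is brought to position 1, by reversing \<open>q\<close> if it is the last
  but one vertex, otherwise by the rotation of \<open>minimal_singleton\<close>. That rotation
  reflects the positions up to \<open>j + 1\<close> and fixes the others.\<close>

lemma minimal_alternating: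
  assumes "minimal p q F" "f \<in> F" "j < length q" "E f (last p) (q ! j)"
  shows "odd (length q) \<and> (\<forall>t < length q. E f (last p) (q ! t) \<longleftrightarrow> odd t)"
proof -
  have cov: "cover p q F" using assms(1) by (rule minimal_cover)
  have k: "length p = 1" using minimal_singleton[OF assms] .
  have len1: "Suc j < length q" using minimal_position_le[OF assms] k by simp
  show ?thesis
  proof (cases "Suc (Suc j) < length q")
    case False
    then have j: "Suc (Suc j) = length q" using len1 by simp
    have "E f (last p) (rev q ! 1)" using assms(4) len1 by (simp add: rev_nth flip: j)
    note alt = minimal_alternating_first[OF minimal_rev_right[OF assms(1)] assms(2) _ this]
    have "odd (length q)" using alt(1) len1 by simp
    moreover have "E f (last p) (q ! t) \<longleftrightarrow> odd t" if "t < length q" for t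
      using alt(2)[of "length q - Suc t"] that len1 \<open>odd (length q)\<close> by (auto simp: rev_nth)
    ultimately show ?thesis by blast
  next
    case len: True
    obtain g where g: "g \<in> F" "g \<noteq> f" using cover_other_colour[OF cov] by metis
    have "\<not> E f (last p) (q ! Suc j)"
      using minimal_not_consecutive[OF assms(1,2) len1 assms(4)] .
    then have e: "E g (hd q) (q ! Suc (Suc j))"
      using cover_complement_right[OF cov assms(2) g(1) len] by simp
    obtain a b where ab: "q = a @ b" "length a = Suc (Suc j)" "a \<noteq> []" "b \<noteq> []" "hd a = hd q"
      "hd b = q ! Suc (Suc j)"
      using split_at_Suc[OF len] by metis
    obtain c where c: "cover p (rev a @ b) (insert c (F - {g}))"
      using cover_rotate[of p a b F g] cov ab(1,3-6) g(1) e by metis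
    have low: "(rev a @ b) ! (Suc j - t) = q ! t" if "t \<le> Suc j" for t
      using ab(2) that unfolding ab(1) by (auto simp: nth_append rev_nth)
    have high: "(rev a @ b) ! t = q ! t" if "\<not> t \<le> Suc j" for t
      using ab that by (simp add: nth_append)
    have l: "length (rev a @ b) = length q" using ab by simp
    have first: "E f (last p) ((rev a @ b) ! 1)" using low[of j] assms(4) by simp
    have f: "f \<in> insert c (F - {g})" using assms g by simp
    note alt = minimal_alternating_first[OF minimal_eq[OF assms(1) c refl] f _ first, unfolded l]
    \<comment> \<open>The reflection sends \<open>t\<close> to \<open>j + 1 - t\<close>, which keeps
      parity only for odd \<open>j\<close>. For even \<open>j\<close> it puts the head of
      \<open>q\<close> at an odd position, making it a neighbour of \<open>last p\<close>.\<close>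
    have "odd j"
    proof
      assume "even j"
      then have "E f (last p) (q ! 0)" using alt(2)[of "Suc j"] low[of 0] len by simp
      then show False using minimal_position_ge[OF assms(1,2), of 0] len k by fastforce
    qed
    have "E f (last p) (q ! t) \<longleftrightarrow> odd t" if "t < length q" for t
    proof (cases "t \<le> Suc j")
      case True
      then show ?thesis using low[OF True] alt(2)[of "Suc j - t"] len \<open>odd j\<close> by auto
    next
      case False
      then show ?thesis using high[OF False] alt(2)[of t] that len by simp
    qed
    then show ?thesis using alt(1) len by simp
  qed
qed

text \<open>Every vertex at an even position of \<open>q\<close> is an end of some path \<open>q'\<close> with the same
  even positions, so its neighbours are the complement of those of \<open>last p\<close>, shifted.\<close>

lemma minimal_even_positions:
  assumes "minimal p q F" "f \<in> F" "j < length q" "E f (last p) (q ! j)"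
    and "i < length q" "even i" "t < length q"
  shows "E f (q ! i) (q ! t) \<longleftrightarrow> odd t"
proof -
  have cov: "cover p q F" using assms(1) by (rule minimal_cover)
  have odd: "odd (length q)" and alt: "\<And>t. t < length q \<Longrightarrow> E f (last p) (q ! t) \<longleftrightarrow> odd t"
    using minimal_alternating[OF assms(1-4)] by auto
  \<comment> \<open>If \<open>i\<close> is the last position, \<open>q'\<close> is
    \<open>rev q\<close>, which keeps parities because \<open>length q\<close> is odd. Otherwise
    \<open>q'\<close> is a rotation sending \<open>t\<close> to \<open>i - t\<close> for
    \<open>t \<le> i\<close>, with \<open>i\<close> even.\<close>
  have "\<exists>q' F'. cover p q' F' \<and> f \<in> F' \<and> q' \<noteq> [] \<and> hd q' = q ! i \<and> length q' = length q \<and>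
    (\<forall>t < length q. \<exists>t' < length q. q' ! t' = q ! t \<and> (odd t' \<longleftrightarrow> odd t))"
  proof (cases "Suc i < length q")
    case False
    then have i: "Suc i = length q" using assms by simp
    have "\<exists>t' < length q. rev q ! t' = q ! t \<and> (odd t' \<longleftrightarrow> odd t)" if "t < length q" for t
      using that odd by (intro exI[of _ "length q - Suc t"]) (auto simp: rev_nth)
    moreover have "i = length q - 1" "q \<noteq> []" using i by auto
    then have "hd (rev q) = q ! i" by (simp add: hd_rev last_conv_nth)
    ultimately show ?thesis
      using cover_rev_right[OF cov] assms(2,3)
      by (intro exI[of _ "rev q"] exI[of _ F]) auto
  next
    case len: True
    obtain g where g: "g \<in> F" "g \<noteq> f" using cover_other_colour[OF cov] by metis
    have e: "E g (hd q) (q ! Suc i)"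
      using cover_complement_right[OF cov assms(2) g(1) len] alt[of i] assms by simp
    obtain a b where ab: "q = a @ b" "length a = Suc i" "a \<noteq> []" "b \<noteq> []" "hd a = hd q"
      "last a = q ! i" "hd b = q ! Suc i"
      using split_at_Suc[OF len] by metis
    obtain c where c: "cover p (rev a @ b) (insert c (F - {g}))"
      using cover_rotate[of p a b F g] cov ab(1,3-7) g(1) e by metis
    have "\<exists>t' < length q. (rev a @ b) ! t' = q ! t \<and> (odd t' \<longleftrightarrow> odd t)" if "t < length q" for t
    proof (cases "t \<le> i")
      case True
      then show ?thesis using ab assms(5,6) by (intro exI[of _ "i - t"]) (auto simp: nth_append rev_nth)
    next
      case False
      then show ?thesis using ab that by (intro exI[of _ t]) (auto simp: nth_append)
    qed
    moreover have "hd (rev a @ b) = q ! i" using ab by (simp add: hd_rev)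
    moreover have "length (rev a @ b) = length q" using ab by simp
    ultimately show ?thesis using c g assms(2) ab
      by (intro exI[of _ "rev a @ b"] exI[of _ "insert c (F - {g})"]) auto
  qed
  then obtain q' F' where q': "cover p q' F'" "f \<in> F'" "q' \<noteq> []" "hd q' = q ! i"
    "length q' = length q"
    and pos: "\<And>t. t < length q \<Longrightarrow> \<exists>t' < length q. q' ! t' = q ! t \<and> (odd t' \<longleftrightarrow> odd t)"
    by blast
  obtain j' where j': "j' < length q'" "E f (last p) (q' ! j')"
    using pos[OF assms(3)] assms(4) q'(5) by metis
  have alt': "\<And>t. t < length q' \<Longrightarrow> E f (last p) (q' ! t) \<longleftrightarrow> odd t"
    using minimal_alternating[OF minimal_eq[OF assms(1) q'(1) refl] q'(2) j'] by blast
  have "E f (hd q') (q' ! s) \<longleftrightarrow> odd s" if "s < length q'" for s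
  proof (cases s)
    case 0
    then show ?thesis using irrefl q' by (simp add: hd_conv_nth)
  next
    case (Suc r)
    then show ?thesis using cover_complement_right[OF q'(1,2,2), of r] alt'[of r] that by simp
  qed
  then show ?thesis using pos[OF assms(7)] q' by metis
qed

text \<open>\<open>S\<close> is the part \<open>Y\<close> of (B3): for
  \<open>length q = 2 * l + 1\<close> it has \<open>l + 2\<close> elements, half of
  \<open>card W + 2\<close>, the size of \<open>V\<close>. Independence in a free colour follows
  from the alternation; other colours are made free first.\<close>

lemma minimal_bipartite:
  assumes "minimal p q F" "f \<in> F" "j < length q" "E f (last p) (q ! j)"
  defines "S \<equiv> insert (last p) {q ! i |i. i < length q \<and> even i}"
  shows "S \<subseteq> W" "2 * card S = card W + 2" "2 \<le> card S"
    and "c \<in> cols \<Longrightarrow> s \<in> S \<Longrightarrow> s' \<in> S \<Longrightarrow> \<not> E c s s'"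
proof -
  have cov: "cover p q F" using assms(1) by (rule minimal_cover)
  have k: "length p = 1" using minimal_singleton[OF assms(1-4)] .
  then obtain x where p: "p = [x]" by (auto simp: length_Suc_conv)
  have odd: "odd (length q)" using minimal_alternating[OF assms(1-4)] by auto
  have W: "W = insert x (set q)" "x \<notin> set q" "distinct q" using cov p by (auto simp: cover_def)
  show "S \<subseteq> W" unfolding S_def using W p by auto
  obtain l where l: "length q = Suc (2 * l)" using odd by (auto elim: oddE)
  have "{q ! i |i. i < length q \<and> even i} = (\<lambda>i. q ! (2 * i)) ` {..l}"
    using l by (auto elim!: evenE)
  moreover have "inj_on (\<lambda>i. q ! (2 * i)) {..l}"
    using W(3) l by (auto simp: inj_on_def nth_eq_iff_index_eq)
  ultimately have "card {q ! i |i. i < length q \<and> even i} = Suc l"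
    by (simp add: card_image)
  moreover have "x \<notin> {q ! i |i. i < length q \<and> even i}" using W(2) by auto
  moreover have "finite {q ! i |i. i < length q \<and> even i}" by simp
  ultimately have cS: "card S = Suc (Suc l)" using p by (simp add: S_def)
  then show "2 * card S = card W + 2" "2 \<le> card S" using cover_length[OF cov] k l by auto
  have indep: "\<not> E c s s'"
    if F': "minimal p q F'" "c \<in> F'" "j' < length q" "E c (last p) (q ! j')"
      and s: "s \<in> S" "s' \<in> S" for F' c s s' j'
  proof -
    have even: "E c (q ! i) (q ! t) \<longleftrightarrow> odd t" if "i < length q" "even i" "t < length q" for i t
      using minimal_even_positions[OF F' that] .
    have x: "E c x (q ! t) \<longleftrightarrow> odd t" if "t < length q" for t
      using minimal_alternating[OF F'] p that by simp
    show ?thesis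
      using s p even x sym[of c _ x] irrefl[of c x] unfolding S_def by auto
  qed
  show "\<not> E c s s'" if c: "c \<in> cols" and s: "s \<in> S" "s' \<in> S"
  proof -
    have qj: "q ! j \<in> W" using W assms(3) by simp
    have "\<exists>F'. minimal p q F' \<and> f \<in> F' \<and> c \<in> F'"
    proof (cases "c \<in> F")
      case True
      then show ?thesis using assms by blast
    next
      case False
      obtain g where g: "g \<in> F" "g \<noteq> f" using cover_other_colour[OF cov] by metis
      have "E g (last p) (q ! j)" using cover_end_colour[OF cov assms(2) g(1) qj] assms(4) by simp
      note even = minimal_even_positions[OF assms(1) g(1) assms(3) this]
      \<comment> \<open>Each edge of \<open>q\<close> joins an even to an odd position and is
        therefore present in colour \<open>g\<close>; \<open>p\<close> has no edge.\<close>
      have "cover p q (insert c (F - {g}))"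
      proof (rule cover_recolour[OF cov g(1) c False])
        fix a b assume "p = a @ b" "a \<noteq> []" "b \<noteq> []"
        then show "E g (last a) (hd b)" using p by (auto simp: Cons_eq_append_conv)
      next
        fix a b assume ab: "q = a @ b" "a \<noteq> []" "b \<noteq> []"
        define i where "i = length a - 1"
        have i: "last a = q ! i" "hd b = q ! Suc i" "Suc i < length q"
          using ab by (auto simp: i_def last_conv_nth hd_conv_nth nth_append)
        show "E g (last a) (hd b)"
          using even[of i "Suc i"] even[of "Suc i" i] i sym by (cases "even i") auto
      qed
      then show ?thesis using minimal_eq[OF assms(1)] g assms(2) by blast
    qed
    then obtain F' where F': "minimal p q F'" "f \<in> F'" "c \<in> F'" by blast
    have "E c (last p) (q ! j)"
      using cover_end_colour[OF minimal_cover[OF F'(1)] F'(2,3) qj] assms(4) by simp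
    from indep[OF F'(1,3) assms(3) this s] show ?thesis .
  qed
qed

text \<open>For a shortest first path, the alternative depends on whether \<open>last p\<close> has
  a neighbour on \<open>q\<close> in one fixed free colour.\<close>

theorem extremal_structure:
  assumes "cover p q F"
  shows "(\<exists>P Q. P \<union> Q = W \<and> P \<inter> Q = {} \<and> P \<noteq> {} \<and> Q \<noteq> {} \<and>
            (\<forall>c\<in>cols. \<forall>z\<in>P. \<forall>w\<in>Q. \<not> E c z w)) \<or>
         (\<exists>S \<subseteq> W. 2 * card S = card W + 2 \<and> 2 \<le> card S \<and>
            (\<forall>c\<in>cols. \<forall>s\<in>S. \<forall>s'\<in>S. \<not> E c s s'))"
proof -
  obtain p q F where min: "minimal p q F"
  proof -
    have "\<exists>q F. cover p q F" using assms by blast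
    from ex_has_least_nat[of "\<lambda>p. \<exists>q F. cover p q F", OF this, of length]
    obtain p' where "\<exists>q F. cover p' q F" "\<And>p''. \<exists>q F. cover p'' q F \<Longrightarrow> length p' \<le> length p''"
      by blast
    then show thesis using that by (auto simp: minimal_def)
  qed
  have cov: "cover p q F" using min by (rule minimal_cover)
  obtain f where f: "f \<in> F" using cover_other_colour[OF cov] by blast
  show ?thesis
  proof (cases "\<exists>w\<in>set q. E f (last p) w")
    case True
    then obtain j where "j < length q" "E f (last p) (q ! j)" by (metis in_set_conv_nth)
    note bip = minimal_bipartite[OF min f this]
    show ?thesis
      by (rule disjI2, rule exI, intro conjI, rule bip(1), rule bip(2), rule bip(3))
         (use bip(4) in blast)
  next
    case False
    have "set p \<union> set q = W" "set p \<inter> set q = {}" "set p \<noteq> {}" "set q \<noteq> {}"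
      using cov by (auto elim: coverE)
    moreover have "\<forall>c\<in>cols. \<forall>z\<in>set p. \<forall>w\<in>set q. \<not> E c z w"
      using minimal_no_cross[OF min f] False by simp
    ultimately show ?thesis by (intro disjI1 exI[of _ "set p"] exI[of _ "set q"] conjI)
  qed
qed

end

section \<open>Edge-maximal collections\<close>

text \<open>\<open>saturated\<close> is edge-maximality unfolded: adding \<open>xy\<close> in colour
  \<open>c\<close> creates a rainbow Hamiltonian path from \<open>u\<close> to \<open>v\<close>,
  which must use this edge; \<open>a\<close> and \<open>b\<close> are what remains after deleting
  it.\<close>

locale saturated_collection =
  fixes E :: "'c \<Rightarrow> 'a \<Rightarrow> 'a \<Rightarrow> bool" and cols :: "'c set" and V :: "'a set" and u v :: 'a
  assumes sym: "E c x y \<Longrightarrow> E c y x"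
    and irrefl: "\<not> E c x x"
    and finite_V: "finite V"
    and finite_cols: "finite cols"
    and card_cols: "card cols = card V"
    and ends: "u \<in> V" "v \<in> V" "u \<noteq> v"
    and ore: "c \<in> cols \<Longrightarrow> x \<in> V \<Longrightarrow> y \<in> V \<Longrightarrow> x \<noteq> y \<Longrightarrow> \<not> E c x y \<Longrightarrow>
      card V \<le> card {z \<in> V. E c x z} + card {z \<in> V. E c y z}"
    and no_ham: "rainbow_path E p C \<Longrightarrow> C \<subseteq> cols \<Longrightarrow> distinct p \<Longrightarrow> set p = V \<Longrightarrow>
      hd p = u \<Longrightarrow> last p = v \<Longrightarrow> False"
    and saturated: "c \<in> cols \<Longrightarrow> x \<in> V \<Longrightarrow> y \<in> V \<Longrightarrow> x \<noteq> y \<Longrightarrow> \<not> E c x y \<Longrightarrow>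
      \<exists>a b A B. rainbow_path E a A \<and> rainbow_path E b B \<and> A \<inter> B = {} \<and> c \<notin> A \<and> c \<notin> B \<and>
        A \<subseteq> cols \<and> B \<subseteq> cols \<and> distinct (a @ b) \<and> set (a @ b) = V \<and> hd a = u \<and> last b = v \<and>
        {last a, hd b} = {x, y}"
begin

text \<open>By this symmetry, only adjacency to \<open>u\<close> has to be proved.\<close>

lemma reverse: "saturated_collection E cols V v u"
proof (unfold_locales, fact sym, fact irrefl, fact finite_V, fact finite_cols, fact card_cols)
  show "v \<in> V" "u \<in> V" "v \<noteq> u" using ends by auto
next
  fix c x y assume "c \<in> cols" "x \<in> V" "y \<in> V" "x \<noteq> y" "\<not> E c x y"
  then show "card V \<le> card {z \<in> V. E c x z} + card {z \<in> V. E c y z}" by (rule ore)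
next
  fix p C assume p: "rainbow_path E p C" "C \<subseteq> cols" "distinct p" "set p = V" "hd p = v" "last p = u"
  have "p \<noteq> []" using p(1) by (rule rainbow_path_nonempty)
  then show False
    using no_ham[OF rainbow_path_rev[OF sym p(1)]] p by (simp add: hd_rev last_rev)
next
  fix c x y assume "c \<in> cols" "x \<in> V" "y \<in> V" "x \<noteq> y" "\<not> E c x y"
  from saturated[OF this] obtain a b A B where *: "rainbow_path E a A" "rainbow_path E b B"
    "A \<inter> B = {}" "c \<notin> A" "c \<notin> B" "A \<subseteq> cols" "B \<subseteq> cols" "distinct (a @ b)" "set (a @ b) = V"
    "hd a = u" "last b = v" "{last a, hd b} = {x, y}" by blast
  have ne: "a \<noteq> []" "b \<noteq> []" using * by (auto dest: rainbow_path_nonempty)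
  have "rainbow_path E (rev b) B" "rainbow_path E (rev a) A"
    using * rainbow_path_rev sym by blast+
  moreover have "{last (rev b), hd (rev a)} = {x, y}" "hd (rev b) = v" "last (rev a) = u"
    using * ne by (auto simp: hd_rev last_rev)
  moreover have "distinct (rev b @ rev a)" "set (rev b @ rev a) = V" "B \<inter> A = {}"
    using * by auto
  ultimately show "\<exists>a b A B. rainbow_path E a A \<and> rainbow_path E b B \<and> A \<inter> B = {} \<and> c \<notin> A \<and> c \<notin> B \<and>
        A \<subseteq> cols \<and> B \<subseteq> cols \<and> distinct (a @ b) \<and> set (a @ b) = V \<and> hd a = v \<and> last b = u \<and>
        {last a, hd b} = {x, y}"
    using *(4-7) by blast
qed

section \<open>The ends are adjacent to the whole interior\<close>

text \<open>If \<open>u\<close> is adjacent to \<open>b ! k\<close> in \<open>c\<close> and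
  \<open>w\<close> to \<open>b ! (k + 1)\<close> in \<open>d\<close>, then going from
  \<open>u\<close> to \<open>b ! k\<close>, back to \<open>w\<close> and on from
  \<open>b ! (k + 1)\<close> is a forbidden path. So \<open>X\<close> and \<open>Y\<close> are
  disjoint sets among \<open>card V - 1\<close> positions.\<close>

lemma start_degree_sum_less:
  assumes b: "rainbow_path E b B" "B \<subseteq> cols" "distinct b" "set b = V - {u}" "hd b = w" "last b = v"
    and cd: "c \<in> cols" "d \<in> cols" "c \<notin> B" "d \<notin> B" "c \<noteq> d" "\<not> E c u w" "\<not> E d u w"
  shows "card {z \<in> V. E c u z} + card {z \<in> V. E d w z} < card V"
proof -
  have ne: "b \<noteq> []" using b(1) by (rule rainbow_path_nonempty)
  have "card (set b) = length b" using b(3) by (rule distinct_card)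
  then have L: "Suc (length b) = card V" using b(4) card_Suc_Diff1[OF finite_V ends(1)] by simp
  define X where "X = {k. k < length b \<and> E c u (b ! k)}"
  define Y where "Y = {k. Suc k < length b \<and> E d w (b ! Suc k)}"
  have "{z \<in> V. E c u z} = {z \<in> set b. E c u z}" using b(4) irrefl by auto
  then have cX: "card {z \<in> V. E c u z} = card X"
    using card_set_filter_nth[OF b(3), of "E c u"] by (simp add: X_def)
  have b0: "b ! 0 = w" using b(5) ne by (simp add: hd_conv_nth)
  have "k \<in> Suc ` Y" if "k < length b" "E d w (b ! k)" for k
    using that b0 irrefl by (cases k) (auto simp: Y_def)
  then have "{k. k < length b \<and> E d w (b ! k)} = Suc ` Y" by (auto simp: Y_def)
  moreover have "{z \<in> V. E d w z} = {z \<in> set b. E d w z}" using b(4) cd(7) sym by auto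
  ultimately have cY: "card {z \<in> V. E d w z} = card Y"
    using card_set_filter_nth[OF b(3), of "E d w"] by (simp add: card_image)
  have "X \<inter> Y = {}"
  proof (rule ccontr)
    assume "X \<inter> Y \<noteq> {}"
    then obtain k where k: "Suc k < length b" "E c u (b ! k)" "E d w (b ! Suc k)"
      by (auto simp: X_def Y_def)
    obtain b1 b2 where s: "b = b1 @ b2" "b1 \<noteq> []" "b2 \<noteq> []" "hd b1 = hd b" "last b1 = b ! k"
      "hd b2 = b ! Suc k"
      using split_at_Suc[OF k(1)] by metis
    obtain B1 B2 e where B: "rainbow_path E b1 B1" "rainbow_path E b2 B2" "B1 \<inter> B2 = {}"
      "e \<notin> B1" "e \<notin> B2" "E e (last b1) (hd b2)" "B = insert e (B1 \<union> B2)"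
      using rainbow_path_split[of E b1 b2 B] b(1) s by metis
    have "E d (last (rev b1)) (hd b2)" using s k(3) b(5) by (simp add: last_rev)
    moreover have "rainbow_path E (rev b1) B1" using rainbow_path_rev[OF sym B(1)] .
    ultimately have "rainbow_path E (rev b1 @ b2) (insert d (B1 \<union> B2))"
      using B cd by (intro rainbow_path_append) auto
    moreover have "hd (rev b1 @ b2) = b ! k" using s(2,5) by (simp add: hd_rev)
    ultimately have "rainbow_path E (u # rev b1 @ b2) (insert c (insert d (B1 \<union> B2)))"
      using B cd k(2) by (intro rainbow_path.Cons) auto
    moreover have "insert c (insert d (B1 \<union> B2)) \<subseteq> cols" using B(7) b(2) cd by auto
    moreover have "distinct (u # rev b1 @ b2)" "set (u # rev b1 @ b2) = V"
      using b(3,4) ends unfolding s(1) by auto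
    moreover have "last (u # rev b1 @ b2) = v" using b(6) s(3) unfolding s(1) by simp
    ultimately show False using no_ham by (metis list.sel(1))
  qed
  moreover have sub: "X \<union> Y \<subseteq> {..<length b}" by (auto simp: X_def Y_def)
  moreover have "finite X" "finite Y" using sub by (auto intro: finite_subset)
  moreover have "card (X \<union> Y) \<le> length b" using card_mono[OF _ sub] by simp
  ultimately show ?thesis using cX cY L by (simp add: card_Un_disjoint)
qed

text \<open>If \<open>uw\<close> is missing in \<open>c\<close>, saturation yields a rainbow path
  \<open>b\<close> from \<open>w\<close> to \<open>v\<close> through \<open>V - {u}\<close>. It has
  \<open>card V - 2\<close> edges and avoids \<open>c\<close>, so a second colour \<open>d\<close>
  is free; \<open>uw\<close> is missing in \<open>d\<close> too. Both mixed degree sums of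
  \<open>u\<close> and \<open>w\<close> are then below \<open>card V\<close>, while the Ore
  condition in \<open>c\<close> and \<open>d\<close> bounds their total from below by
  \<open>2 * card V\<close>.\<close>

lemma start_adj:
  assumes "c \<in> cols" "w \<in> V" "w \<noteq> u" "w \<noteq> v"
  shows "E c u w"
proof (rule ccontr)
  assume nadj: "\<not> E c u w"
  from saturated[OF assms(1) ends(1) assms(2) assms(3)[symmetric] nadj]
  obtain a b A B where *: "rainbow_path E a A" "rainbow_path E b B" "A \<inter> B = {}" "c \<notin> A" "c \<notin> B"
    "A \<subseteq> cols" "B \<subseteq> cols" "distinct (a @ b)" "set (a @ b) = V" "hd a = u" "last b = v"
    "{last a, hd b} = {u, w}" by blast
  have ne: "a \<noteq> []" "b \<noteq> []" using * by (auto dest: rainbow_path_nonempty)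
  then have "hd b \<noteq> u" using *(8,10) by (metis disjoint_iff distinct_append hd_in_set)
  then have hl: "last a = u" "hd b = w" using *(12) assms(3) by (auto simp: doubleton_eq_iff)
  have a: "a = [u]"
  proof (cases a)
    case Nil
    then show ?thesis using ne by simp
  next
    case (Cons y a')
    then show ?thesis using hl(1) *(8,10) by (auto split: if_splits)
  qed
  have b: "set b = V - {u}" "distinct b" using *(8,9) a by auto
  have "card (set b) = card V - 1" using b(1) ends by simp
  then have len: "length b = card V - 1" using distinct_card[OF b(2)] by simp
  have "Suc (card B) = length b" using rainbow_path_card[OF *(2)] by simp
  then have "card (insert c B) < card cols"
    using len card_cols rainbow_path_finite[OF *(2)] *(5) by simp
  then have "\<not> cols \<subseteq> insert c B"
    using card_mono[of "insert c B" cols] rainbow_path_finite[OF *(2)] by auto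
  then obtain d where d: "d \<in> cols" "d \<noteq> c" "d \<notin> B" by blast
  have nadj_d: "\<not> E d u w"
  proof
    assume "E d u w"
    then have "rainbow_path E (u # b) (insert d B)" using d(3) *(2) hl(2) by (intro rainbow_path.Cons) auto
    then show False using no_ham[of "u # b" "insert d B"] d *(7,11) b ends ne by auto
  qed
  note less = start_degree_sum_less[OF *(2,7) b(2,1) hl(2) *(11)]
  have "card {z \<in> V. E c u z} + card {z \<in> V. E d w z} < card V"
    using assms(1) d *(5) nadj nadj_d by (intro less) auto
  moreover have "card {z \<in> V. E d u z} + card {z \<in> V. E c w z} < card V"
    using assms(1) d *(5) nadj nadj_d by (intro less) auto
  moreover have "card V \<le> card {z \<in> V. E c u z} + card {z \<in> V. E c w z}"
    using assms ends nadj by (intro ore) auto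
  moreover have "card V \<le> card {z \<in> V. E d u z} + card {z \<in> V. E d w z}"
    using assms ends nadj_d d by (intro ore) auto
  ultimately show False by linarith
qed

lemma end_adj:
  assumes "c \<in> cols" "w \<in> V" "w \<noteq> u" "w \<noteq> v"
  shows "E c v w"
  using saturated_collection.start_adj[OF reverse assms(1,2,4,3)] .

text \<open>On two vertices the Ore condition forces the edge \<open>uv\<close>, which is itself the
  forbidden path.\<close>

lemma interior_nonempty: "V - {u, v} \<noteq> {}"
proof
  assume "V - {u, v} = {}"
  then have V: "V = {u, v}" using ends by auto
  then have "card cols = 2" using card_cols ends by simp
  then obtain c where c: "c \<in> cols" by fastforce
  show False
  proof (cases "E c u v")
    case True
    have "rainbow_path E [u, v] (insert c {})"
      using True by (intro rainbow_path.Cons rainbow_path.single) auto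
    then show False using no_ham[of "[u, v]" "{c}"] c V ends by auto
  next
    case False
    then have "{z \<in> V. E c u z} = {}" "{z \<in> V. E c v z} = {}" using V irrefl sym by auto
    then have "card V \<le> 0" using ore[OF c ends False] by (simp only: card.empty)
    then show False using finite_V ends by auto
  qed
qed

lemma card_interior: "card V = card (V - {u, v}) + 2"
proof -
  have "card {u, v} = 2" using ends by simp
  moreover have "card {u, v} \<le> card V" using ends finite_V by (intro card_mono) auto
  moreover have "card (V - {u, v}) = card V - card {u, v}"
    using ends by (intro card_Diff_subset) auto
  ultimately show ?thesis by simp
qed

text \<open>A rainbow Hamiltonian path of the interior would leave three colours free; two of them
  suffice to attach \<open>u\<close> and \<open>v\<close> at its ends.\<close>

lemma interior: "ore_collection E cols (V - {u, v})"
proof (unfold_locales, fact sym, fact irrefl)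
  show "finite (V - {u, v})" "finite cols" using finite_V finite_cols by auto
  show "card cols = card (V - {u, v}) + 2" using card_cols card_interior by simp
next
  fix c x y assume c: "c \<in> cols" and xy: "x \<in> V - {u, v}" "y \<in> V - {u, v}" "x \<noteq> y" "\<not> E c x y"
  have "card {z \<in> V. E c w z} \<le> card {z \<in> V - {u, v}. E c w z} + 2" for w
  proof -
    have "card {z \<in> V. E c w z} \<le> card ({z \<in> V - {u, v}. E c w z} \<union> {u, v})"
      using finite_V by (intro card_mono) auto
    also have "\<dots> \<le> card {z \<in> V - {u, v}. E c w z} + card {u, v}" by (rule card_Un_le)
    finally show ?thesis using ends by simp
  qed
  from this[of x] this[of y] ore[OF c _ _ xy(3,4)] xy card_interior
  show "card (V - {u, v}) \<le>
    card {z \<in> V - {u, v}. E c x z} + card {z \<in> V - {u, v}. E c y z} + 2"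
    by auto
next
  fix p C assume p: "rainbow_path E p C" "distinct p" "set p = V - {u, v}" "C \<subseteq> cols"
  have ne: "p \<noteq> []" using p(1) by (rule rainbow_path_nonempty)
  have fin: "finite C" using p(1) by (rule rainbow_path_finite)
  have "card (cols - C) = card cols - card C" using p fin by (intro card_Diff_subset) auto
  moreover have "Suc (card C) = card (V - {u, v})"
    using rainbow_path_card[OF p(1)] distinct_card[OF p(2)] p(3) by simp
  ultimately have "card (cols - C) = 3" using card_cols card_interior by simp
  then obtain c d where cd: "c \<in> cols" "c \<notin> C" "d \<in> cols" "d \<notin> C" "c \<noteq> d"
    by (auto simp: card_3_iff)
  have mem: "hd p \<in> V - {u, v}" "last p \<in> V - {u, v}" using ne p(3) by (metis hd_in_set last_in_set)+
  have "rainbow_path E (p @ [v]) (insert d (C \<union> {}))"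
    using p cd mem end_adj sym by (intro rainbow_path_append rainbow_path.single) auto
  then have "rainbow_path E (u # p @ [v]) (insert c (insert d C))"
    using cd mem start_adj ne by (intro rainbow_path.Cons) auto
  then show False using no_ham[of "u # p @ [v]" "insert c (insert d C)"] p cd ends by auto
qed

text \<open>Some colour misses an edge \<open>xy\<close> of the interior, since otherwise any
  ordering of the interior would be a rainbow path. Saturation at \<open>xy\<close> gives two paths,
  from which \<open>u\<close> and \<open>v\<close> are removed; both stay nonempty because
  \<open>x\<close> and \<open>y\<close> are interior.\<close>

lemma exists_cover: "\<exists>p q F. ore_collection.cover E cols (V - {u, v}) p q F"
proof -
  interpret W: ore_collection E cols "V - {u, v}" by (rule interior)
  have "\<exists>c \<in> cols. \<exists>x \<in> V - {u, v}. \<exists>y \<in> V - {u, v}. x \<noteq> y \<and> \<not> E c x y"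
  proof (rule ccontr)
    assume complete: "\<not> ?thesis"
    obtain p where p: "set p = V - {u, v}" "distinct p"
      using finite_distinct_list[of "V - {u, v}"] finite_V by auto
    have "length p \<noteq> 0" using p(1) interior_nonempty by (metis length_0_conv set_empty)
    have "length p - 1 \<le> card cols" using p card_cols card_interior distinct_card[OF p(2)] by simp
    then obtain C where C: "C \<subseteq> cols" "card C = length p - 1"
      using obtain_subset_with_card_n by metis
    have "rainbow_path E p C"
    proof (rule rainbow_path_of_complete)
      show "finite C" using C finite_cols finite_subset by blast
      show "length p = Suc (card C)" using C \<open>length p \<noteq> 0\<close> by simp
      show "E c x y" if "c \<in> C" "x \<in> set p" "y \<in> set p" "x \<noteq> y" for c x y
        using complete that C(1) unfolding p(1) by blast
    qed (fact p(2))
    then show False using W.no_ham p C by blast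
  qed
  then obtain c x y where c: "c \<in> cols" and xy: "x \<in> V - {u, v}" "y \<in> V - {u, v}" "x \<noteq> y" "\<not> E c x y"
    by blast
  from saturated[OF c _ _ xy(3,4)] xy(1,2)
  obtain a b A B where *: "rainbow_path E a A" "rainbow_path E b B" "A \<inter> B = {}"
    "A \<subseteq> cols" "B \<subseteq> cols" "distinct (a @ b)" "set (a @ b) = V" "hd a = u" "last b = v"
    "{last a, hd b} = {x, y}" by blast
  have ne: "a \<noteq> []" "b \<noteq> []" using * by (auto dest: rainbow_path_nonempty)
  have "last a \<in> {x, y}" "hd b \<in> {x, y}" using *(10) by blast+
  then have nuv: "last a \<noteq> u" "hd b \<noteq> v" using xy by auto
  define p q where "p = tl a" and "q = butlast b"
  have a: "a = [u] @ p" using ne(1) *(8) by (metis append_Cons append_Nil list.collapse p_def)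
  have b: "b = q @ [v]" using ne(2) *(9) by (metis append_butlast_last_id q_def)
  have "p \<noteq> []" "q \<noteq> []" using a b nuv by auto
  then obtain A' B' where AB: "rainbow_path E p A'" "rainbow_path E q B'" "A' \<subseteq> A" "B' \<subseteq> B"
    using rainbow_path_split[of E "[u]" p A] rainbow_path_split[of E q "[v]" B] *(1,2) a b
    by (metis Un_upper1 Un_upper2 not_Cons_self2 subset_insertI2)
  have "W.cover p q (cols - (A' \<union> B'))"
    using AB * a b by (intro W.coverI[of p A' q B']) auto
  then show ?thesis by blast
qed

theorem extremal_structure:
  "(\<exists>P Q. P \<union> Q = V - {u, v} \<and> P \<inter> Q = {} \<and> P \<noteq> {} \<and> Q \<noteq> {} \<and>
            (\<forall>c\<in>cols. \<forall>z\<in>P. \<forall>w\<in>Q. \<not> E c z w)) \<or>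
         (\<exists>S \<subseteq> V - {u, v}. 2 * card S = card V \<and> 2 \<le> card S \<and>
            (\<forall>c\<in>cols. \<forall>s\<in>S. \<forall>s'\<in>S. \<not> E c s s'))"
  using exists_cover ore_collection.extremal_structure[OF interior] card_interior by metis

end

section \<open>Collections of graphs\<close>

lemma degree_eq_card_neighbours:
  assumes "simple_graph V H"
  shows "degree H x = card {z \<in> V. {x, z} \<in> H}"
proof -
  have H: "H \<subseteq> [V]\<^bsup>2\<^esup>" using assms by (simp add: simple_graph_def)
  have "{e \<in> H. x \<in> e} = (\<lambda>z. {x, z}) ` {z \<in> V. {x, z} \<in> H}"
  proof (intro set_eqI iffI)
    fix e assume e: "e \<in> {e \<in> H. x \<in> e}"
    then have "e \<in> [V]\<^bsup>2\<^esup>" using H by blast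
    then obtain y z where "e = {y, z}" "y \<in> V" "z \<in> V" by (auto simp: nsets_2_eq)
    then show "e \<in> (\<lambda>z. {x, z}) ` {z \<in> V. {x, z} \<in> H}" using e by (auto simp: insert_commute)
  qed auto
  moreover have "inj_on (\<lambda>z. {x, z}) {z \<in> V. {x, z} \<in> H}"
    by (auto simp: inj_on_def doubleton_eq_iff)
  ultimately show ?thesis unfolding degree_def by (simp add: card_image)
qed

lemma sigma2_degree_sum:
  assumes "enat n \<le> sigma2 V H" "x \<in> V" "y \<in> V" "x \<noteq> y" "{x, y} \<notin> H"
  shows "n \<le> degree H x + degree H y"
proof -
  have "sigma2 V H \<le> enat (degree H x + degree H y)"
    unfolding sigma2_def using assms by (intro Inf_lower) blast
  with assms(1) have "enat n \<le> enat (degree H x + degree H y)" by (rule order_trans)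
  then show ?thesis by simp
qed

section \<open>Coloured edge sets of paths\<close>

lemma path_edges_Cons: "p \<noteq> [] \<Longrightarrow> path_edges (x # p) = insert {x, hd p} (path_edges p)"
proof -
  assume ne: "p \<noteq> []"
  have "{x, hd p} \<in> path_edges (x # p)"
    unfolding path_edges_def using ne by (auto simp: hd_conv_nth intro!: exI[of _ 0])
  moreover have "path_edges p \<subseteq> path_edges (x # p)"
    unfolding path_edges_def by (auto 0 0) (metis Suc_less_eq nth_Cons_Suc)
  moreover have "path_edges (x # p) \<subseteq> insert {x, hd p} (path_edges p)"
  proof
    fix e assume "e \<in> path_edges (x # p)"
    then obtain i where i: "e = {(x # p) ! i, p ! i}" "i < length p"
      by (auto simp: path_edges_def)
    show "e \<in> insert {x, hd p} (path_edges p)"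
    proof (cases i)
      case 0
      then show ?thesis using i ne by (simp add: hd_conv_nth)
    next
      case (Suc j)
      then show ?thesis using i by (auto simp: path_edges_def)
    qed
  qed
  ultimately show ?thesis by blast
qed

lemma path_edges_subset: "distinct p \<Longrightarrow> path_edges p \<subseteq> [set p]\<^bsup>2\<^esup>"
  by (auto simp: path_edges_def nsets_def card_insert_if nth_eq_iff_index_eq)

lemma rainbow_path_colouring:
  assumes "rainbow_path (\<lambda>c x y. {x, y} \<in> G c) p C" "distinct p"
  shows "\<exists>c. inj_on c (path_edges p) \<and> c ` path_edges p = C \<and> (\<forall>e\<in>path_edges p. e \<in> G (c e))"
  using assms
proof (induction rule: rainbow_path.induct)
  case (single x)
  then show ?case by (simp add: path_edges_def)
next
  case (Cons d x p C)
  then obtain c where c: "inj_on c (path_edges p)" "c ` path_edges p = C"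
    "\<forall>e\<in>path_edges p. e \<in> G (c e)"
    by auto
  have ne: "p \<noteq> []" using Cons.hyps(3) by (rule rainbow_path_nonempty)
  have new: "{x, hd p} \<notin> path_edges p"
    using path_edges_subset[of p] Cons.prems by (auto simp: nsets_def)
  define c' where "c' = c({x, hd p} := d)"
  have eq: "c' e = c e" if "e \<in> path_edges p" for e using that new by (auto simp: c'_def)
  then have img: "c' ` path_edges p = C" using c(2) by simp
  have "inj_on c' (path_edges p)" using c(1) eq by (auto simp: inj_on_def)
  moreover have "c' {x, hd p} = d" by (simp add: c'_def)
  ultimately have "inj_on c' (path_edges (x # p)) \<and> c' ` path_edges (x # p) = insert d C \<and>
    (\<forall>e\<in>path_edges (x # p). e \<in> G (c' e))"
    using ne Cons.hyps(1,2) img new c(3) eq by (simp add: path_edges_Cons)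
  then show ?case by blast
qed

lemma hamiltonian_rainbow_path:
  assumes "rainbow_path (\<lambda>c x y. {x, y} \<in> G c) p C" "C \<subseteq> {1..n}" "distinct p" "set p = V"
    "hd p = u" "last p = v"
  shows "hamiltonian_path V u v p \<and> contains_rainbow V n G (set p) (path_edges p)"
proof -
  have "p \<noteq> []" using assms(1) by (rule rainbow_path_nonempty)
  then show ?thesis
    using assms rainbow_path_colouring[OF assms(1,3)] path_edges_subset[OF assms(3)]
    by (auto simp: hamiltonian_path_def contains_rainbow_def simple_graph_def)
qed

text \<open>\<open>K\<close> is an edge-maximal collection containing \<open>G\<close>, as a set of pairs of a colour and an edge.\<close>

lemma saturated_extension:
  fixes V :: "'a set" and G :: "nat \<Rightarrow> 'a set set"
  assumes pos: "n > 0" and card: "card V = n"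
    and graph: "\<And>i. i \<in> {1..n} \<Longrightarrow> simple_graph V (G i)"
    and ore: "\<And>i. i \<in> {1..n} \<Longrightarrow> sigma2 V (G i) \<ge> enat n"
    and uv: "u \<in> V" "v \<in> V" "u \<noteq> v"
    and none: "\<nexists>p C. rainbow_path (\<lambda>c x y. {x, y} \<in> G c) p C \<and> C \<subseteq> {1..n} \<and> distinct p \<and>
      set p = V \<and> hd p = u \<and> last p = v"
  obtains K where "saturated_collection (\<lambda>c x y. (c, {x, y}) \<in> K) {1..n} V u v"
    "\<And>i e. i \<in> {1..n} \<Longrightarrow> e \<in> G i \<Longrightarrow> (i, e) \<in> K"
proof -
  have finV: "finite V" using graph[of 1] pos by (simp add: simple_graph_def)
  define E where "E K = (\<lambda>c x y. (c, {x, y}) \<in> K)" for K :: "(nat \<times> 'a set) set"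
  define good where "good K \<longleftrightarrow> (\<nexists>p C. rainbow_path (E K) p C \<and> C \<subseteq> {1..n} \<and> distinct p \<and>
      set p = V \<and> hd p = u \<and> last p = v)" for K
  define K0 where "K0 = Sigma {1..n} G"
  \<comment> \<open>Restricting to colours in \<open>{1..n}\<close> and to pairs of vertices makes
    the family finite, so it has a maximal member.\<close>
  define \<K> where "\<K> = {K. K0 \<subseteq> K \<and> K \<subseteq> {1..n} \<times> [V]\<^bsup>2\<^esup> \<and> good K}"
  have "finite ({1..n} \<times> [V]\<^bsup>2\<^esup>)" using finV by (simp add: finite_imp_finite_nsets)
  then have "finite \<K>" unfolding \<K>_def by (auto intro: finite_subset[of _ "Pow ({1..n} \<times> [V]\<^bsup>2\<^esup>)"])
  have "good K0"
    unfolding good_def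
  proof
    assume "\<exists>p C. rainbow_path (E K0) p C \<and> C \<subseteq> {1..n} \<and> distinct p \<and> set p = V \<and> hd p = u \<and> last p = v"
    then obtain p C where p: "rainbow_path (E K0) p C" "C \<subseteq> {1..n}" "distinct p" "set p = V"
      "hd p = u" "last p = v" by blast
    have "rainbow_path (\<lambda>c x y. {x, y} \<in> G c) p C"
      by (rule rainbow_path_mono[OF p(1)]) (auto simp: E_def K0_def)
    then show False using none p by blast
  qed
  moreover have "G i \<subseteq> [V]\<^bsup>2\<^esup>" if "i \<in> {1..n}" for i
    using graph[OF that] by (simp add: simple_graph_def)
  then have "K0 \<subseteq> {1..n} \<times> [V]\<^bsup>2\<^esup>" unfolding K0_def by blast
  ultimately have "K0 \<in> \<K>" by (simp add: \<K>_def)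
  then obtain K where K: "K \<in> \<K>" and max: "\<And>K'. K' \<in> \<K> \<Longrightarrow> K \<subseteq> K' \<Longrightarrow> K = K'"
    using finite_has_maximal2[OF \<open>finite \<K>\<close>] by metis
  have K0: "K0 \<subseteq> K" and sub: "K \<subseteq> {1..n} \<times> [V]\<^bsup>2\<^esup>" and good: "good K"
    using K by (auto simp: \<K>_def)
  have sat: "saturated_collection (E K) {1..n} V u v"
  proof (unfold_locales, simp_all only: finV uv not_False_eq_True)
    show "E K c y x" if "E K c x y" for c x y using that by (simp add: E_def insert_commute)
    show "\<not> E K c x x" for c x using sub by (auto simp: E_def nsets_def)
    show "finite {1..n}" "card {1..n} = card V" using card by auto
  next
    fix c x y assume c: "c \<in> {1..n}" and xy: "x \<in> V" "y \<in> V" "x \<noteq> y" "\<not> E K c x y"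
    have G: "(c, e) \<in> K" if "e \<in> G c" for e using K0 c that by (auto simp: K0_def)
    then have "{x, y} \<notin> G c" using xy by (auto simp: E_def)
    then have "n \<le> degree (G c) x + degree (G c) y"
      using sigma2_degree_sum[OF ore[OF c] xy(1-3)] by simp
    moreover have "degree (G c) w \<le> card {z \<in> V. E K c w z}" for w
      unfolding degree_eq_card_neighbours[OF graph[OF c]]
      using finV G by (intro card_mono) (auto simp: E_def)
    ultimately show "card V \<le> card {z \<in> V. E K c x z} + card {z \<in> V. E K c y z}"
      using card by (meson add_mono order_trans)
  next
    fix p C assume "rainbow_path (E K) p C" "C \<subseteq> {1..n}" "distinct p" "set p = V" "hd p = u" "last p = v"
    then show False using good by (auto simp: good_def)
  next
    fix c x y assume c: "c \<in> {1..n}" and xy: "x \<in> V" "y \<in> V" "x \<noteq> y" "\<not> E K c x y"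
    define K' where "K' = insert (c, {x, y}) K"
    have "K' \<noteq> K" using xy by (auto simp: K'_def E_def)
    moreover have "K0 \<subseteq> K'" "K' \<subseteq> {1..n} \<times> [V]\<^bsup>2\<^esup>"
      using K0 sub c xy by (auto simp: K'_def nsets_2_eq)
    ultimately have "\<not> good K'" using max[of K'] by (auto simp: \<K>_def K'_def)
    then obtain p C where p: "rainbow_path (E K') p C" "C \<subseteq> {1..n}" "distinct p" "set p = V"
      "hd p = u" "last p = v" by (auto simp: good_def)
    have not_K: "\<not> rainbow_path (E K) p C" using good p by (auto simp: good_def)
    have restrict: "rainbow_path (E K) q D" if "rainbow_path (E K') q D" "c \<notin> D" for q D
      by (rule rainbow_path_mono[OF that(1)]) (use that(2) in \<open>auto simp: E_def K'_def\<close>)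
    \<comment> \<open>A path without colour \<open>c\<close> would already exist in
      \<open>K\<close>. Cutting at \<open>c\<close> isolates the added edge, for an edge of
      \<open>K\<close> at this place would give the path in \<open>K\<close> as well.\<close>
    have "c \<in> C" using restrict p(1) not_K by blast
    then obtain a b A B where s: "p = a @ b" "rainbow_path (E K') a A" "rainbow_path (E K') b B"
      "A \<inter> B = {}" "c \<notin> A" "c \<notin> B" "E K' c (last a) (hd b)" "C = insert c (A \<union> B)"
      using rainbow_path_split_colour[OF p(1)] by metis
    have ab: "rainbow_path (E K) a A" "rainbow_path (E K) b B" using s restrict by blast+
    have ne: "a \<noteq> []" "b \<noteq> []" using ab by (auto dest: rainbow_path_nonempty)
    have "\<not> E K c (last a) (hd b)"
      using rainbow_path_append[OF ab s(4-6)] not_K s(1,8) by blast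
    then have "{last a, hd b} = {x, y}" using s(7) by (auto simp: E_def K'_def)
    moreover have "A \<subseteq> {1..n}" "B \<subseteq> {1..n}" using s(8) p(2) by auto
    moreover have "hd a = u" "last b = v" "distinct (a @ b)" "set (a @ b) = V"
      using p s(1) ne by auto
    ultimately show "\<exists>a b A B. rainbow_path (E K) a A \<and> rainbow_path (E K) b B \<and> A \<inter> B = {} \<and>
        c \<notin> A \<and> c \<notin> B \<and> A \<subseteq> {1..n} \<and> B \<subseteq> {1..n} \<and> distinct (a @ b) \<and> set (a @ b) = V \<and>
        hd a = u \<and> last b = v \<and> {last a, hd b} = {x, y}"
      using ab s(4-6) by blast
  qed
  have "(i, e) \<in> K" if "i \<in> {1..n}" "e \<in> G i" for i e
    using K0 that by (auto simp: K0_def)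
  then show thesis using that sat by (simp add: E_def)
qed

section \<open>Equality in the degree condition\<close>

text \<open>The Ore bound leaves no room below \<open>card A + card B\<close>. In this way missing
  edges of a graph force the presence of others.\<close>

lemma neighbourhoods_eq:
  assumes graph: "simple_graph V H" and sigma: "sigma2 V H \<ge> enat n"
    and xy: "x \<in> V" "y \<in> V" "x \<noteq> y" "{x, y} \<notin> H"
    and sub: "{z \<in> V. {x, z} \<in> H} \<subseteq> A" "{z \<in> V. {y, z} \<in> H} \<subseteq> B"
    and fin: "finite A" "finite B" and card: "card A + card B \<le> n"
  shows "{z \<in> V. {x, z} \<in> H} = A" "{z \<in> V. {y, z} \<in> H} = B"
proof -
  have "n \<le> card {z \<in> V. {x, z} \<in> H} + card {z \<in> V. {y, z} \<in> H}"
    using sigma2_degree_sum[OF sigma xy] degree_eq_card_neighbours[OF graph] by simp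
  moreover have "card {z \<in> V. {x, z} \<in> H} \<le> card A" "card {z \<in> V. {y, z} \<in> H} \<le> card B"
    using sub fin by (auto intro: card_mono)
  ultimately have "card {z \<in> V. {x, z} \<in> H} = card A" "card {z \<in> V. {y, z} \<in> H} = card B"
    using card by linarith+
  then show "{z \<in> V. {x, z} \<in> H} = A" "{z \<in> V. {y, z} \<in> H} = B"
    using sub fin by (simp_all add: card_subset_eq)
qed

text \<open>A vertex \<open>z\<close> of \<open>P\<close> has neighbours only in
  \<open>{u, v}\<close> and \<open>P - {z}\<close>, and likewise for \<open>Q\<close>. The two
  bounds add up to \<open>card P + card Q + 2 = n\<close>, so all these edges are present.\<close>

lemma no_cross_edges_structure:
  assumes graph: "simple_graph V H" and sigma: "sigma2 V H \<ge> enat n" and card: "card V = n"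
    and uv: "u \<in> V" "v \<in> V" "u \<noteq> v"
    and PQ: "P \<union> Q = V - {u, v}" "P \<inter> Q = {}" "P \<noteq> {}" "Q \<noteq> {}"
    and cross: "\<And>z w. z \<in> P \<Longrightarrow> w \<in> Q \<Longrightarrow> {z, w} \<notin> H"
  shows "disjoint_cliques H P Q \<and> (\<forall>w\<in>P \<union> Q. {u, w} \<in> H \<and> {v, w} \<in> H)"
proof -
  have finV: "finite V" and H: "H \<subseteq> [V]\<^bsup>2\<^esup>" using graph by (auto simp: simple_graph_def)
  have "P \<subseteq> V" "Q \<subseteq> V" using PQ by auto
  then have fin: "finite P" "finite Q" using finV finite_subset by blast+
  have "{u, v} \<subseteq> V" "card {u, v} = 2" using uv by auto
  then have "card (P \<union> Q) = n - 2" "2 \<le> n"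
    using PQ(1) card finV card_mono[of V "{u, v}"] by (auto simp: card_Diff_subset)
  then have cPQ: "card P + card Q + 2 = n" using card_Un_disjoint[OF fin PQ(2)] by simp
  have loop: "{z, z} \<notin> H" for z using H by (auto simp: nsets_def)
  have cross': "{w, z} \<notin> H" if "w \<in> Q" "z \<in> P" for z w
    using cross[OF that(2,1)] by (simp add: insert_commute)
  have V: "V = insert u (insert v (P \<union> Q))" using PQ(1) uv by blast
  have nb: "{z' \<in> V. {z, z'} \<in> H} = insert u (insert v (P - {z})) \<and>
      {w' \<in> V. {w, w'} \<in> H} = insert u (insert v (Q - {w}))" if zw: "z \<in> P" "w \<in> Q" for z w
  proof -
    have uvPQ: "u \<notin> P" "v \<notin> P" "u \<notin> Q" "v \<notin> Q" using PQ(1) by blast+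
    have "card P > 0" "card Q > 0" using zw fin by (auto simp: card_gt_0_iff)
    then have c: "card (insert u (insert v (P - {z}))) + card (insert u (insert v (Q - {w}))) \<le> n"
      using zw fin uv uvPQ cPQ by (simp add: card_insert_if)
    have sub: "{z' \<in> V. {z, z'} \<in> H} \<subseteq> insert u (insert v (P - {z}))"
      "{w' \<in> V. {w, w'} \<in> H} \<subseteq> insert u (insert v (Q - {w}))"
      using cross[OF zw(1)] cross'[OF zw(2)] loop V by blast+
    have "z \<in> V" "w \<in> V" "z \<noteq> w" using zw PQ by auto
    from neighbourhoods_eq[OF graph sigma this cross[OF zw] sub _ _ c] show ?thesis using fin by simp
  qed
  obtain z0 w0 where z0w0: "z0 \<in> P" "w0 \<in> Q" using PQ by blast
  have nbP: "{z' \<in> V. {z, z'} \<in> H} = insert u (insert v (P - {z}))" if "z \<in> P" for z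
    using nb[OF that z0w0(2)] by blast
  have nbQ: "{w' \<in> V. {w, w'} \<in> H} = insert u (insert v (Q - {w}))" if "w \<in> Q" for w
    using nb[OF z0w0(1) that] by blast
  have "clique P (induced_edges H P)" "clique Q (induced_edges H Q)"
    using nbP nbQ unfolding clique_def induced_edges_def by blast+
  moreover have "bipartite_edges H P Q = {}" using cross by (auto simp: bipartite_edges_def)
  moreover have "{u, w} \<in> H \<and> {v, w} \<in> H" if "w \<in> P \<union> Q" for w
  proof -
    have "u \<in> {z' \<in> V. {w, z'} \<in> H}" "v \<in> {z' \<in> V. {w, z'} \<in> H}" using nbP nbQ that by blast+
    then show ?thesis by (simp add: insert_commute)
  qed
  ultimately show ?thesis using PQ(2) by (simp add: disjoint_cliques_def)
qed

text \<open>Two distinct vertices of \<open>S\<close> have all their neighbours in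
  \<open>V - S\<close>, which has \<open>n / 2\<close> elements, so the Ore bound makes them
  adjacent to all of it. The bound \<open>2 \<le> card S\<close> supplies the second vertex.\<close>

lemma independent_half_structure:
  assumes graph: "simple_graph V H" and sigma: "sigma2 V H \<ge> enat n" and card: "card V = n"
    and S: "S \<subseteq> V" "2 * card S = n" "2 \<le> card S"
    and indep: "\<And>s s'. s \<in> S \<Longrightarrow> s' \<in> S \<Longrightarrow> {s, s'} \<notin> H"
  shows "complete_bipartite (V - S) S (bipartite_edges H (V - S) S)"
proof -
  have finV: "finite V" using graph by (simp add: simple_graph_def)
  then have finS: "finite S" using S finite_subset by blast
  have "card (V - S) = card S" using S card finS by (simp add: card_Diff_subset)
  then have c: "card (V - S) + card (V - S) \<le> n" using S by simp
  have "{x, s} \<in> H" if s: "s \<in> S" and x: "x \<in> V - S" for s x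
  proof -
    have "card (S - {s}) \<noteq> 0" using S s by simp
    then obtain s' where s': "s' \<in> S" "s' \<noteq> s" by (metis DiffE card.empty ex_in_conv singletonI)
    have sub: "{z \<in> V. {t, z} \<in> H} \<subseteq> V - S" if "t \<in> S" for t using indep that by auto
    have "s \<in> V" "s' \<in> V" using s s' S by auto
    from neighbourhoods_eq(1)[OF graph sigma this s'(2)[symmetric] indep[OF s s'(1)] sub[OF s]
        sub[OF s'(1)] _ _ c]
    have "{z \<in> V. {s, z} \<in> H} = V - S" using finV by simp
    then have "{s, x} \<in> H" using x by blast
    then show ?thesis by (simp add: insert_commute)
  qed
  then show ?thesis unfolding complete_bipartite_def bipartite_edges_def by blast
qed

theorem theorem1p5:
  fixes n :: nat and V :: "'a set" and G :: "nat \<Rightarrow> 'a set set" and u v :: 'a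
  assumes "n > 0" and "card V = n"
    and "\<And>i. i \<in> {1..n} \<Longrightarrow> simple_graph V (G i)"
    and "\<And>i. i \<in> {1..n} \<Longrightarrow> sigma2 V (G i) \<ge> enat n"
    and "u \<in> V" and "v \<in> V" and "u \<noteq> v"
  shows
    "(\<exists>p. hamiltonian_path V u v p \<and> contains_rainbow V n G (set p) (path_edges p)) \<or>
     (\<exists>X Y. X \<union> Y = V - {u, v} \<and> X \<inter> Y = {} \<and> card X \<ge> 1 \<and> card Y \<ge> 1 \<and>
        (\<forall>i\<in>{1..n}. disjoint_cliques (G i) X Y \<and>
           (\<forall>w\<in>X \<union> Y. {u, w} \<in> G i \<and> {v, w} \<in> G i))) \<or>
     (even n \<and>
      (\<exists>X Y. X \<union> Y = V \<and> X \<inter> Y = {} \<and> card X = n div 2 \<and> card Y = n div 2 \<and>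
         u \<in> X \<and> v \<in> X \<and>
         (\<forall>i\<in>{1..n}. complete_bipartite X Y (bipartite_edges (G i) X Y))))"
proof (cases "\<exists>p C. rainbow_path (\<lambda>c x y. {x, y} \<in> G c) p C \<and> C \<subseteq> {1..n} \<and> distinct p \<and>
      set p = V \<and> hd p = u \<and> last p = v")
  case True
  then obtain p C where "rainbow_path (\<lambda>c x y. {x, y} \<in> G c) p C" "C \<subseteq> {1..n}" "distinct p"
    "set p = V" "hd p = u" "last p = v" by blast
  from hamiltonian_rainbow_path[OF this] show ?thesis by (intro disjI1 exI)
next
  case False
  obtain K where sat: "saturated_collection (\<lambda>c x y. (c, {x, y}) \<in> K) {1..n} V u v"
    and K: "\<And>i e. i \<in> {1..n} \<Longrightarrow> e \<in> G i \<Longrightarrow> (i, e) \<in> K"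
    using saturated_extension[OF assms(1-7) False] by blast
  have finV: "finite V" using sat by (simp add: saturated_collection_def)
  \<comment> \<open>Both alternatives assert only that edges are missing from \<open>K\<close>, and
    so hold for every \<open>G i\<close> as well.\<close>
  from saturated_collection.extremal_structure[OF sat] show ?thesis
  proof (elim disjE exE conjE)
    fix P Q assume PQ: "P \<union> Q = V - {u, v}" "P \<inter> Q = {}" "P \<noteq> {}" "Q \<noteq> {}"
      and cross: "\<forall>c\<in>{1..n}. \<forall>z\<in>P. \<forall>w\<in>Q. (c, {z, w}) \<notin> K"
    have "P \<subseteq> V" "Q \<subseteq> V" using PQ by auto
    then have "card P \<ge> 1" "card Q \<ge> 1"
      using PQ(3,4) finite_subset[OF _ finV] by (simp_all add: Suc_le_eq card_gt_0_iff)
    moreover have "\<forall>i\<in>{1..n}. disjoint_cliques (G i) P Q \<and> (\<forall>w\<in>P \<union> Q. {u, w} \<in> G i \<and> {v, w} \<in> G i)"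
    proof
      fix i assume i: "i \<in> {1..n}"
      show "disjoint_cliques (G i) P Q \<and> (\<forall>w\<in>P \<union> Q. {u, w} \<in> G i \<and> {v, w} \<in> G i)"
      proof (rule no_cross_edges_structure[OF assms(3,4)[OF i] assms(2,5-7) PQ])
        show "{z, w} \<notin> G i" if "z \<in> P" "w \<in> Q" for z w using K[OF i] cross i that by blast
      qed
    qed
    ultimately show ?thesis using PQ by blast
  next
    \<comment> \<open>\<open>S\<close> plays the part of \<open>Y\<close> in (B3) and
      \<open>V - S\<close>, which contains \<open>u\<close> and \<open>v\<close>, that of
      \<open>X\<close>.\<close>
    fix S assume S: "S \<subseteq> V - {u, v}" "2 * card S = card V" "2 \<le> card S"
      and indep: "\<forall>c\<in>{1..n}. \<forall>s\<in>S. \<forall>s'\<in>S. (c, {s, s'}) \<notin> K"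
    have sub: "S \<subseteq> V" using S by blast
    then have "card (V - S) = card V - card S" using finV finite_subset by (metis card_Diff_subset)
    then have card: "even n" "card (V - S) = n div 2" "card S = n div 2"
      using S(2) assms(2) by auto
    have "\<forall>i\<in>{1..n}. complete_bipartite (V - S) S (bipartite_edges (G i) (V - S) S)"
    proof
      fix i assume i: "i \<in> {1..n}"
      show "complete_bipartite (V - S) S (bipartite_edges (G i) (V - S) S)"
      proof (rule independent_half_structure[OF assms(3,4)[OF i] assms(2) sub _ S(3)])
        show "2 * card S = n" using S(2) assms(2) by simp
        show "{s, s'} \<notin> G i" if "s \<in> S" "s' \<in> S" for s s' using K[OF i] indep i that by blast
      qed
    qed
    moreover have "(V - S) \<union> S = V" "(V - S) \<inter> S = {}" "u \<in> V - S" "v \<in> V - S"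
      using sub S(1) assms(5,6) by auto
    ultimately show ?thesis using card by blast
  qed
qed

end
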